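(* Let $K_0\in\mathbb{K}$ with $J(K_0)=\alpha$, and suppose $X_0\succ 0$. Let $L$ be the constant defined in the context (with this $\alpha$), let $\eta\in(0,1/L]$, and let $(K_i)_{i\ge 0}$ be generated by the vanilla policy gradient method $$K_{i+1}=K_i-\eta\nabla J(K_i).$$ Then: (i) $J(K_i)$ is monotonically diminishing in $i$, i.e. $J(K_{i+1})\le J(K_i)$ for all $i$ (so $K_i\in\mathbb{K}_\alpha\subseteq\mathbb{K}$ for all $i$, i.e. every $K_i$ is stabilizing). (ii) For every $\epsilon>0$, an $\epsilon$-stationary point, i.e. an iterate $K_i$ with $\|\nabla J(K_i)\|_F\le\epsilon$, is obtained within $$\frac{2\alpha}{\eta\epsilon^2}$$ iterations. (iii) For each iteration $i$, the line segment $[K_i,K_{i+1}]$ is contained in $\mathbb{K}_\alpha$. (iv) If $d=n$ and $C$ has rank $n$, then for every $\epsilon_J>0$ the iterate $K_N$ satisfies $J(K_N)-J_s^\star\le\epsilon_J$ whenever $$N\ge \frac{\|\Sigma_{K^\star}\|}{2\eta\mu^2\sigma_{\min}(C)^2\sigma_{\min}(R)}\log\left(\frac{J(K_0)-J_s^\star}{\epsilon_J}\right).$$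
   Context: Setting (static output feedback, SOF). $A\in\mathbb{R}^{n\times n}$, $B\in\mathbb{R}^{n\times m}$, $C\in\mathbb{R}^{d\times n}$; $(A,B)$ is controllable, $(C,A)$ is observable, and $C$ has linearly independent rows. $Q\in\mathbb{R}^{n\times n}$ and $R\in\mathbb{R}^{m\times m}$ are symmetric positive definite. $\mathcal{D}$ is a probability distribution on $\mathbb{R}^n$ with $X_0:=\mathbb{E}_{x_0\sim\mathcal{D}}[x_0x_0^\top]\succ 0$, and $\mu:=\sigma_{\min}(X_0)>0$. For $K\in\mathbb{R}^{m\times d}$ put $\mathcal{A}_K:=A-BKC$. The set of stabilizing gains is $\mathbb{K}:=\{K\in\mathbb{R}^{m\times d}:\rho(\mathcal{A}_K)<1\}$ ($\rho$ is the spectral radius), assumed nonempty. For $K\in\mathbb{K}$, $$J(K):=\mathbb{E}_{x_0\sim\mathcal{D}}\Big[\sum_{t=0}^\infty x_t^\top(Q+C^\top K^\top RKC)x_t\Big],\quad x_{t+1}=\mathcal{A}_Kx_t,\qquad \Sigma_K:=\mathbb{E}_{x_0\sim\mathcal{D}}\sum_{t=0}^\infty x_tx_t^\top .$$ Equivalently $J(K)=\mathrm{Tr}(P_KX_0)=\mathrm{Tr}((Q+C^\top K^\top RKC)\Sigma_K)$, where $P_K=Q+C^\top K^\top RKC+\mathcal{A}_K^\top P_K\mathcal{A}_K$ and $\Sigma_K=X_0+\mathcal{A}_K\Sigma_K\mathcal{A}_K^\top$. $K^\star$ is a global minimizer of $J$ over $\mathbb{K}$. $\mathbb{K}_\alpha:=\{K\in\mathbb{K}: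 J(K)\le\alpha\}$. $\nabla J(K)\in\mathbb{R}^{m\times d}$ is the gradient with respect to the entries of $K$. $J_s^\star$ is the globally optimal cost of the corresponding full-state-feedback LQR problem, i.e. the minimum of $\mathbb{E}_{x_0\sim\mathcal{D}}[\sum_{t\ge0}(x_t^\top Qx_t+u_t^\top Ru_t)]$ with $x_{t+1}=Ax_t+Bu_t$, $u_t=-K_sx_t$, over all $K_s\in\mathbb{R}^{m\times n}$ with $\rho(A-BK_s)<1$. Constants: $$L=\frac{2\alpha}{\sigma_{\min}(Q)}\left(\|R\|+\frac{\alpha}{\mu}\Big(1+\frac{2\zeta_1}{\|B\|\|C\|}\Big)\|B\|^2\right)\|C\|^2,$$ $$\zeta_1=\frac{1}{\sigma_{\min}(Q)}\left(\frac{\alpha}{\mu}(1+\|B\|^2\|C\|^2)+\|R\|\|C\|^2\right)-1 .$$ Notation: $\|\cdot\|$ is the induced 2-norm, $\|\cdot\|_F$ the Frobenius norm, $\sigma_{\min}$ the minimal singular value. *)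

theory Defs
  imports "HOL-Analysis.Analysis" "HOL-Probability.Probability"
begin

definition eigenvalues :: "'a::field^'n^'n \<Rightarrow> 'a set" where
  "eigenvalues M = {l. \<exists>v. v \<noteq> 0 \<and> M *v v = l *s v}"

definition spectral_radius :: "real^'n^'n \<Rightarrow> real" where
  "spectral_radius M = Max (cmod ` eigenvalues (\<chi> i j. complex_of_real (M $ i $ j)))"

text \<open>
  A \<open>p \<times> q\<close> matrix has \<open>min p q\<close> singular values; the case split selects the smaller of the
  two Gram matrices, so that for non-square matrices no spurious zeros appear.
\<close>

definition singular_values :: "real^'c^'r \<Rightarrow> real set" where
  "singular_values M = sqrt ` (if CARD('c) \<le> CARD('r) then eigenvalues (transpose M ** M)
                               else eigenvalues (M ** transpose M))"

definition sigma_min :: "real^'c^'r \<Rightarrow> real" where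
  "sigma_min M = Min (singular_values M)"

text \<open>
  The type class norm on \<open>real^'c^'r\<close> is the Frobenius norm (and the inner product is the trace
  inner product); the induced 2-norm is the operator norm below.
\<close>

definition opnorm :: "real^'c^'r \<Rightarrow> real" where
  "opnorm M = onorm ((*v) M)"

definition pos_def :: "real^'n^'n \<Rightarrow> bool" where
  "pos_def M \<longleftrightarrow> transpose M = M \<and> (\<forall>x. x \<noteq> 0 \<longrightarrow> x \<bullet> (M *v x) > 0)"

definition controllable :: "real^'n^'n \<Rightarrow> real^'m^'n \<Rightarrow> bool" where
  "controllable A B \<longleftrightarrow>
     (\<forall>x0 x1. \<exists>(u :: nat \<Rightarrow> real^'m) (x :: nat \<Rightarrow> real^'n) N.
        x 0 = x0 \<and> (\<forall>t. x (Suc t) = A *v x t + B *v u t) \<and> x N = x1)"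

definition observable :: "real^'n^'d \<Rightarrow> real^'n^'n \<Rightarrow> bool" where
  "observable C A \<longleftrightarrow>
     (\<forall>x y. (\<forall>t. C *v (((*v) A ^^ t) x) = C *v (((*v) A ^^ t) y)) \<longrightarrow> x = y)"

text \<open>
  \<^const>\<open>rows\<close> is a set and would identify equal rows, hence the injectivity requirement.
\<close>

definition lin_indep_rows :: "real^'n^'d \<Rightarrow> bool" where
  "lin_indep_rows C \<longleftrightarrow> inj (\<lambda>i. row i C) \<and> independent (rows C)"

definition outer :: "real^'n \<Rightarrow> real^'n^'n" where
  "outer x = (\<chi> i j. x $ i * x $ j)"

definition second_moment :: "(real^'n) measure \<Rightarrow> real^'n^'n" where
  "second_moment D = (LINT x|D. outer x)"

definition closed_loop :: "real^'n^'n \<Rightarrow> real^'m^'n \<Rightarrow> real^'n^'d \<Rightarrow> real^'d^'m \<Rightarrow> real^'n^'n" where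
  "closed_loop A B C K = A - B ** K ** C"

definition stabilizing :: "real^'n^'n \<Rightarrow> real^'m^'n \<Rightarrow> real^'n^'d \<Rightarrow> (real^'d^'m) set" where
  "stabilizing A B C = {K. spectral_radius (closed_loop A B C K) < 1}"

definition state :: "real^'n^'n \<Rightarrow> real^'n \<Rightarrow> nat \<Rightarrow> real^'n" where
  "state M x0 t = ((*v) M ^^ t) x0"

text \<open>
  The cost and the state correlation matrix are meaningful only for stabilizing gains: elsewhere
  the series may diverge, and the values are the library defaults.
\<close>

definition sof_cost ::
  "real^'n^'n \<Rightarrow> real^'m^'n \<Rightarrow> real^'n^'d \<Rightarrow> real^'n^'n \<Rightarrow> real^'m^'m \<Rightarrow> (real^'n) measure
    \<Rightarrow> real^'d^'m \<Rightarrow> real" where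
  "sof_cost A B C Q R D K =
     (LINT x0|D. (\<Sum>t. state (closed_loop A B C K) x0 t \<bullet>
        ((Q + transpose C ** transpose K ** R ** K ** C) *v state (closed_loop A B C K) x0 t)))"

definition state_corr ::
  "real^'n^'n \<Rightarrow> real^'m^'n \<Rightarrow> real^'n^'d \<Rightarrow> (real^'n) measure \<Rightarrow> real^'d^'m \<Rightarrow> real^'n^'n" where
  "state_corr A B C D K = (LINT x0|D. (\<Sum>t. outer (state (closed_loop A B C K) x0 t)))"

definition sof_sublevel ::
  "real^'n^'n \<Rightarrow> real^'m^'n \<Rightarrow> real^'n^'d \<Rightarrow> real^'n^'n \<Rightarrow> real^'m^'m \<Rightarrow> (real^'n) measure
    \<Rightarrow> real \<Rightarrow> (real^'d^'m) set" where
  "sof_sublevel A B C Q R D \<alpha> = {K \<in> stabilizing A B C. sof_cost A B C Q R D K \<le> \<alpha>}"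

definition gradient :: "('a::real_inner \<Rightarrow> real) \<Rightarrow> 'a \<Rightarrow> 'a" where
  "gradient f x = (THE g. GDERIV f x :> g)"

definition sf_cost ::
  "real^'n^'n \<Rightarrow> real^'m^'n \<Rightarrow> real^'n^'n \<Rightarrow> real^'m^'m \<Rightarrow> (real^'n) measure
    \<Rightarrow> real^'n^'m \<Rightarrow> real" where
  "sf_cost A B Q R D Ks =
     (LINT x0|D. (\<Sum>t.
        let x = ((\<lambda>y. A *v y + B *v (- (Ks *v y))) ^^ t) x0; u = - (Ks *v x)
        in x \<bullet> (Q *v x) + u \<bullet> (R *v u)))"

text \<open>
  The costs are nonnegative, and the infimum below is attained for the problems considered here
  (\<open>Q\<close>, \<open>R\<close> and the second moment positive definite, \<open>(A, B)\<close> controllable), so it is the minimum.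
\<close>

definition sf_opt_cost ::
  "real^'n^'n \<Rightarrow> real^'m^'n \<Rightarrow> real^'n^'n \<Rightarrow> real^'m^'m \<Rightarrow> (real^'n) measure \<Rightarrow> real" where
  "sf_opt_cost A B Q R D =
     (INF Ks \<in> {Ks :: real^'n^'m. spectral_radius (A - B ** Ks) < 1}. sf_cost A B Q R D Ks)"

definition zeta1 ::
  "real^'m^'n \<Rightarrow> real^'n^'d \<Rightarrow> real^'n^'n \<Rightarrow> real^'m^'m \<Rightarrow> real \<Rightarrow> real \<Rightarrow> real" where
  "zeta1 B C Q R \<mu> \<alpha> =
     1 / sigma_min Q *
       (\<alpha> / \<mu> * (1 + (opnorm B)\<^sup>2 * (opnorm C)\<^sup>2) + opnorm R * (opnorm C)\<^sup>2) - 1"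

definition smooth_const ::
  "real^'m^'n \<Rightarrow> real^'n^'d \<Rightarrow> real^'n^'n \<Rightarrow> real^'m^'m \<Rightarrow> real \<Rightarrow> real \<Rightarrow> real" where
  "smooth_const B C Q R \<mu> \<alpha> =
     2 * \<alpha> / sigma_min Q *
       (opnorm R + \<alpha> / \<mu> * (1 + 2 * zeta1 B C Q R \<mu> \<alpha> / (opnorm B * opnorm C)) * (opnorm B)\<^sup>2)
       * (opnorm C)\<^sup>2"

end

theory Submission
  imports Defs "HOL-Computational_Algebra.Fundamental_Theorem_Algebra"
begin

text \<open>
  For a stable closed loop \<open>M = A - B K C\<close> the cost is \<open>J K = X\<^sub>0 \<bullet> P\<close>, where \<open>P\<close> solves the
  discrete Lyapunov equation \<open>P = Q + C\<^sup>T K\<^sup>T R K C + M\<^sup>T P M\<close>. Differentiating this equation twice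
  and bounding its derivative \<open>P'\<close> between multiples of \<open>P\<close> shows that on the sublevel set
  \<open>J \<le> \<alpha>\<close> the second derivative of \<open>J\<close> in a direction \<open>Z\<close> is at most \<open>L \<parallel>Z\<parallel>\<^sup>2\<close>. Since the
  Lyapunov function \<open>P\<close> is uniformly bounded on the sublevel set, stability survives limits, so a
  gradient step of size at most \<open>1 / L\<close> cannot leave the set and the usual descent estimate holds along it. If \<open>C\<close> is
  invertible, completing the square in the exact cost difference bounds \<open>J K - J K\<^sup>\<star>\<close> by a multiple of
  the squared gradient norm, and the linear rate follows.
\<close>

section \<open>Eigenvalues and Schur stability\<close>

text \<open>The spectral radius is traded at the outset for square summability of all trajectories,
  which can be certified by bounds on partial sums. After that everything rests on one operator, the
  Lyapunov series \<open>lyap M\<close>, and on its adjoint \<open>lyap (transpose M)\<close>: the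
  cost-to-go \<open>P\<close> and the state correlation \<open>S\<close> are its values, and
  adjointness gives J = X0 . P = S . W. Since X0 dominates \<mu> I and W dominates \<sigma> I, the
  two readings bound tr P by \<alpha>/\<mu> and tr S by \<alpha>/\<sigma> on the sublevel set; these
  are the quotients in \<open>L\<close>. The operator also preserves semidefiniteness, so a
  comparison of right-hand sides of Lyapunov equations carries over to their solutions. The obstacle
  is a circularity: the curvature is bounded only on the sublevel set, and outside the stabilizing
  gains the cost has no meaning, so a Taylor estimate along a step presupposes that the step stays
  inside. The segment is therefore followed up to the first parameter at which it could
  leave.\<close>

declare transpose_matrix_vector [simp del]

text \<open>\<open>dependent\<close> speaks of sets, so a repeated value of \<open>f\<close> is lost
  in the image; in that case the difference of the two equal terms is itself the relation.\<close>

lemma exists_linear_relation: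
  fixes f :: "nat \<Rightarrow> 'a::euclidean_space"
  shows "\<exists>u m. (\<exists>k\<le>m. u k \<noteq> (0::real)) \<and> (\<Sum>k\<le>m. u k *\<^sub>R f k) = 0"
proof -
  define m where "m = DIM('a)"
  show ?thesis
  proof (cases "inj_on f {..m}")
    case True
    then have "card (f ` {..m}) > DIM('a)" by (simp add: card_image m_def)
    then have "dependent (f ` {..m})" by (simp add: dependent_biggerset)
    then obtain u v where u: "(\<Sum>v\<in>f ` {..m}. u v *\<^sub>R v) = 0" "v \<in> f ` {..m}" "u v \<noteq> 0"
      by (auto simp: dependent_finite)
    then have "(\<Sum>k\<le>m. u (f k) *\<^sub>R f k) = 0"
      using sum.reindex[OF True, of "\<lambda>v. u v *\<^sub>R v"] by (simp add: o_def)
    with u show ?thesis by (intro exI[of _ "\<lambda>k. u (f k)"] exI[of _ m]) auto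
  next
    case False
    then obtain i j where ij: "i \<le> m" "j \<le> m" "i \<noteq> j" "f i = f j" by (auto simp: inj_on_def)
    define u where "u k = (if k = i then 1 else if k = j then -1 else (0::real))" for k
    have "(\<Sum>k\<le>m. u k *\<^sub>R f k) = (\<Sum>k\<le>m. (if k = i then f k else 0) - (if k = j then f k else 0))"
      by (rule sum.cong) (use ij in \<open>auto simp: u_def\<close>)
    also have "\<dots> = 0" using ij by (simp add: sum_subtractf)
    finally show ?thesis using ij by (intro exI[of _ u] exI[of _ m]) (auto simp: u_def)
  qed
qed

lemma mult_funpow_mat_1:
  fixes M :: "'a::field^'n^'n"
  shows "((**) M ^^ k) (mat 1) *v v = ((*v) M ^^ k) v"
  by (induction k) (auto simp: matrix_vector_mul_assoc[symmetric])

lemma sum_matrix_vector_mult: "(\<Sum>k\<in>S. F k) *v v = (\<Sum>k\<in>S. F k *v (v::'a::field^'n))"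
  by (induction S rule: infinite_finite_induct) (auto simp: matrix_vector_mult_add_rdistrib)

lemma matrix_vector_mult_sum: "M *v (\<Sum>k\<in>S. F k) = (\<Sum>k\<in>S. M *v (F k::'a::field^'n))"
  by (induction S rule: infinite_finite_induct) (auto simp: matrix_vector_right_distrib)

text \<open>The powers of \<open>M\<close> lie in a real vector space of finite dimension, so some
  nontrivial combination of them vanishes. Its real coefficients are read as complex ones because
  the roots of the polynomial are needed.\<close>

lemma annihilating_poly:
  fixes M :: "complex^'n^'n"
  obtains p :: "complex poly" where "p \<noteq> 0"
    "\<And>v n. degree p \<le> n \<Longrightarrow> (\<Sum>k\<le>n. coeff p k *s ((*v) M ^^ k) v) = 0"
proof -
  obtain u m where u: "\<exists>k\<le>m. u k \<noteq> (0::real)"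
    "(\<Sum>k\<le>m. u k *\<^sub>R ((**) M ^^ k) (mat 1)) = 0"
    using exists_linear_relation[of "\<lambda>k. ((**) M ^^ k) (mat 1)"] by blast
  define p where "p = (\<Sum>k\<le>m. monom (complex_of_real (u k)) k)"
  have c: "coeff p k = (if k \<le> m then complex_of_real (u k) else 0)" for k
    by (auto simp: p_def coeff_sum)
  from u(1) have "p \<noteq> 0" using c by (metis coeff_0 of_real_eq_0_iff)
  moreover have "(\<Sum>k\<le>n. coeff p k *s ((*v) M ^^ k) v) = 0" if "degree p \<le> n" for v n
  proof -
    have "(\<Sum>k\<le>n. coeff p k *s ((*v) M ^^ k) v) = (\<Sum>k\<le>n+m. coeff p k *s ((*v) M ^^ k) v)"
      by (rule sum.mono_neutral_left) (use that in \<open>auto simp: coeff_eq_0\<close>)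
    also have "\<dots> = (\<Sum>k\<le>m. coeff p k *s ((*v) M ^^ k) v)"
      by (rule sum.mono_neutral_right) (auto simp: c)
    also have "\<dots> = (\<Sum>k\<le>m. (u k *\<^sub>R ((**) M ^^ k) (mat 1)) *v v)"
      by (rule sum.cong)
        (auto simp: c mult_funpow_mat_1[symmetric] vec_eq_iff matrix_vector_mult_def sum_distrib_left
            scaleR_conv_of_real[where 'a = complex] mult.assoc)
    also have "\<dots> = 0"
      unfolding sum_matrix_vector_mult[symmetric] u(2) by simp
    finally show ?thesis .
  qed
  ultimately show thesis by (rule that)
qed

lemma funpow_eigenvector:
  fixes M :: "'a::field^'n^'n"
  assumes "M *v v = l *s v"
  shows "((*v) M ^^ k) v = l ^ k *s v"
  by (induction k) (use assms in \<open>auto simp: vector_smult_assoc vector_scalar_commute mult.commute\<close>)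

lemma finite_eigenvalues_complex: "finite (eigenvalues (M::complex^'n^'n))"
proof -
  obtain p :: "complex poly" where p: "p \<noteq> 0"
    "\<And>v n. degree p \<le> n \<Longrightarrow> (\<Sum>k\<le>n. coeff p k *s ((*v) M ^^ k) v) = 0"
    using annihilating_poly[of M] by blast
  have "poly p l = 0" if "l \<in> eigenvalues M" for l
  proof -
    from that obtain v where v: "v \<noteq> 0" "M *v v = l *s v" by (auto simp: eigenvalues_def)
    have "poly p l *s v = (\<Sum>k\<le>degree p. coeff p k *s ((*v) M ^^ k) v)"
      by (simp add: funpow_eigenvector[OF v(2)] poly_altdef vec_eq_iff sum_distrib_right mult.assoc)
    also have "\<dots> = 0" using p(2) by simp
    finally show ?thesis using v(1) by simp
  qed
  then have "eigenvalues M \<subseteq> {l. poly p l = 0}" by auto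
  then show ?thesis using poly_roots_finite[OF p(1)] finite_subset by blast
qed

text \<open>
  A vector is killed by a product of factors \<open>M - l\<close>; the factors for which \<open>l\<close> is not an
  eigenvalue are injective and can be dropped.
\<close>

lemma eigenvalue_induct [consumes 0, case_names zero step]:
  fixes M :: "complex^'n^'n"
  assumes "P 0"
    and step: "\<And>l v. l \<in> eigenvalues M \<Longrightarrow> P (M *v v - l *s v) \<Longrightarrow> P v"
  shows "P v"
proof -
  \<comment> \<open>The induction is on a bound for the degree, for all \<open>p\<close> and
    \<open>v\<close> at once: dividing out a root lowers the bound, and the vector may change as
    well.\<close>
  have *: "P v" if "p \<noteq> 0" "degree p \<le> n" "(\<Sum>k\<le>n. coeff p k *s ((*v) M ^^ k) v) = 0" for n p v
    using that
  proof (induction n arbitrary: p v)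
    case 0
    then have "coeff p 0 \<noteq> 0" by (metis le_zero_eq leading_coeff_0_iff)
    with 0 show ?case using assms(1) by simp
  next
    case (Suc n)
    show ?case
    proof (cases "degree p = 0")
      case True
      then have "coeff p 0 \<noteq> 0" using Suc.prems by (metis leading_coeff_0_iff)
      have "(\<Sum>k\<le>Suc n. coeff p k *s ((*v) M ^^ k) v) = (\<Sum>k\<in>{0}. coeff p k *s ((*v) M ^^ k) v)"
        by (rule sum.mono_neutral_right) (auto simp: coeff_eq_0 True)
      then have "v = 0" using Suc.prems \<open>coeff p 0 \<noteq> 0\<close> by simp
      then show ?thesis using assms(1) by simp
    next
      case False
      then obtain l where "poly p l = 0"
        using fundamental_theorem_of_algebra[of p] by (auto simp: constant_degree)
      then obtain q where q: "p = [:- l, 1:] * q" by (auto simp: poly_eq_0_iff_dvd elim: dvdE)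
      have q0: "q \<noteq> 0" using q Suc.prems(1) by auto
      have dq: "degree q \<le> n" using q0 Suc.prems(2) unfolding q by (simp add: degree_mult_eq del: mult_pCons_left)
      define w where "w = M *v v - l *s v"
      have cS: "coeff p (Suc k) = coeff q k - l * coeff q (Suc k)" for k by (simp add: q)
      have c0: "coeff p 0 = - l * coeff q 0" by (simp add: q)
      have comm: "((*v) M ^^ k) (M *v v) = M *v ((*v) M ^^ k) v" for k
        by (induction k) auto
      have Mw: "((*v) M ^^ k) w = M *v ((*v) M ^^ k) v - l *s ((*v) M ^^ k) v" for k
        by (induction k) (auto simp: w_def matrix_vector_mult_diff_distrib vector_scalar_commute)
      let ?g = "\<lambda>k. coeff q k *s ((*v) M ^^ k) v"
      \<comment> \<open>Coefficient form of p(M) v = (M - l) q(M) v.\<close>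
      have "(\<Sum>k\<le>Suc n. coeff p k *s ((*v) M ^^ k) v)
        = (- l * coeff q 0) *s v + (\<Sum>k\<le>n. coeff q k *s (M *v ((*v) M ^^ k) v) - l *s ?g (Suc k))"
        by (subst sum.atMost_Suc_shift)
          (auto simp: c0 cS vec_eq_iff algebra_simps)
      also have "\<dots> = (\<Sum>k\<le>n. coeff q k *s (M *v ((*v) M ^^ k) v)) - l *s (\<Sum>k\<le>Suc n. ?g k)"
        unfolding sum.atMost_Suc_shift[of ?g n]
        by (simp add: sum_subtractf vec_eq_iff algebra_simps sum_distrib_left)
      also have "(\<Sum>k\<le>Suc n. ?g k) = (\<Sum>k\<le>n. ?g k)" using dq by (simp add: coeff_eq_0)
      finally have 0: "(\<Sum>k\<le>n. coeff q k *s (M *v ((*v) M ^^ k) v)) - l *s (\<Sum>k\<le>n. ?g k) = 0"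
        using Suc.prems(3) by simp
      show ?thesis
      proof (cases "l \<in> eigenvalues M")
        case True
        \<comment> \<open>q(M) commutes with M - l, so \<open>q\<close> annihilates
          \<open>w\<close>.\<close>
        have "(\<Sum>k\<le>n. coeff q k *s ((*v) M ^^ k) w) = 0"
          using 0 unfolding Mw
          by (simp add: sum_subtractf vec_eq_iff algebra_simps sum_distrib_left)
        from Suc.IH[OF q0 dq this] show ?thesis using step[OF True] w_def by blast
      next
        case False
        have "M *v (\<Sum>k\<le>n. ?g k) = l *s (\<Sum>k\<le>n. ?g k)"
          using 0 by (simp add: matrix_vector_mult_sum vector_scalar_commute)
        then have "(\<Sum>k\<le>n. ?g k) = 0" using False by (auto simp: eigenvalues_def)
        from Suc.IH[OF q0 dq this] show ?thesis .
      qed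
    qed
  qed
  obtain p :: "complex poly" where "p \<noteq> 0"
    "\<And>v n. degree p \<le> n \<Longrightarrow> (\<Sum>k\<le>n. coeff p k *s ((*v) M ^^ k) v) = 0"
    using annihilating_poly[of M] by blast
  then show ?thesis using *[of p "degree p" v] by simp
qed

text \<open>Without eigenvalues the step case of \<open>eigenvalue_induct\<close> is vacuous and
  every vector would be zero. Together with finiteness this makes the \<open>Max\<close> in
  \<open>spectral_radius\<close> a genuine maximum.\<close>

lemma eigenvalues_nonempty_complex: "eigenvalues (M::complex^'n^'n) \<noteq> {}"
proof
  assume "eigenvalues M = {}"
  then have "v = 0" for v :: "complex^'n"
    by (induction v rule: eigenvalue_induct[of _ M]) auto
  then show False by (metis one_neq_zero zero_index one_index)
qed

text \<open>Square summability is what makes the Lyapunov series converge;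
  \<open>spectral_radius_less_1_iff\<close> identifies it with the spectral condition.\<close>

definition schur_stable :: "real^'n^'n \<Rightarrow> bool" where
  "schur_stable M \<longleftrightarrow> (\<forall>x. summable (\<lambda>t. (norm (state M x t))\<^sup>2))"

lemma state_0 [simp]: "state M x 0 = x"
  and state_Suc: "state M x (Suc t) = M *v state M x t"
  by (simp_all add: state_def)

abbreviation cmatrix :: "real^'n^'m \<Rightarrow> complex^'n^'m" where
  "cmatrix M \<equiv> (\<chi> i j. complex_of_real (M $ i $ j))"

lemma Re_cmatrix_mult: "(\<chi> i. Re ((cmatrix M *v v) $ i)) = M *v (\<chi> i. Re (v $ i))"
  and Im_cmatrix_mult: "(\<chi> i. Im ((cmatrix M *v v) $ i)) = M *v (\<chi> i. Im (v $ i))"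
  by (simp_all add: matrix_vector_mult_def vec_eq_iff)

lemma cmatrix_mult_of_real:
  "cmatrix M *v (\<chi> i. complex_of_real (x $ i)) = (\<chi> i. complex_of_real ((M *v x) $ i))"
  by (simp add: matrix_vector_mult_def vec_eq_iff)

text \<open>Takes the place of the Jordan form: if w = M v - l v decays like r^t, then M^(t+1) v =
  M^t w + l M^t v, and this recursion decays at the same rate because |l| < r.\<close>

lemma geometric_decay_complex:
  fixes M :: "complex^'n^'n"
  assumes r: "0 < r" "\<And>l. l \<in> eigenvalues M \<Longrightarrow> cmod l < r"
  shows "\<exists>c\<ge>0. \<forall>t. norm (((*v) M ^^ t) v) \<le> c * r ^ t"
proof (induction v rule: eigenvalue_induct[of _ M])
  case zero
  have "((*v) M ^^ t) 0 = 0" for t by (induction t) auto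
  then show ?case by (intro exI[of _ 0]) auto
next
  case (step l v)
  then obtain c where c: "c \<ge> 0" "\<And>t. norm (((*v) M ^^ t) (M *v v - l *s v)) \<le> c * r ^ t" by blast
  have lr: "cmod l < r" using r(2) step(1) .
  have Mw: "((*v) M ^^ k) (M *v v - l *s v) = M *v ((*v) M ^^ k) v - l *s ((*v) M ^^ k) v" for k
    by (induction k) (auto simp: matrix_vector_mult_diff_distrib vector_scalar_commute)
  \<comment> \<open>Chosen so that c + |l| c' \<le> r c', which makes the bound c' r^t reproduce
    itself; the maximum with \<open>norm v\<close> starts the induction.\<close>
  define c' where "c' = max (norm v) (c / (r - cmod l))"
  have c': "norm v \<le> c'" "c \<le> c' * (r - cmod l)"
    using lr by (auto simp: c'_def pos_divide_le_eq[symmetric])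
  have "c' \<ge> 0" using c'(1) norm_ge_zero order_trans by blast
  have "norm (((*v) M ^^ t) v) \<le> c' * r ^ t" for t
  proof (induction t)
    case (Suc t)
    have nl: "norm (l *s x) = cmod l * norm x" for x :: "complex^'n"
      by (simp add: norm_vec_def norm_mult L2_set_right_distrib)
    have "((*v) M ^^ Suc t) v = ((*v) M ^^ t) (M *v v - l *s v) + l *s ((*v) M ^^ t) v"
      by (simp add: Mw)
    then have "norm (((*v) M ^^ Suc t) v)
        \<le> norm (((*v) M ^^ t) (M *v v - l *s v)) + cmod l * norm (((*v) M ^^ t) v)"
      using norm_triangle_ineq nl by metis
    also have "\<dots> \<le> c * r ^ t + cmod l * (c' * r ^ t)"
      using c(2)[of t] Suc by (intro add_mono mult_left_mono) auto
    also have "\<dots> \<le> c' * (r - cmod l) * r ^ t + cmod l * (c' * r ^ t)"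
      using c' r \<open>c' \<ge> 0\<close> by (intro add_mono mult_right_mono) auto
    also have "\<dots> = c' * r ^ Suc t" by (simp add: algebra_simps)
    finally show ?case .
  qed (use c' in auto)
  with \<open>c' \<ge> 0\<close> show ?case by blast
qed

lemma spectral_radius_less_1_iff:
  fixes M :: "real^'n^'n"
  shows "spectral_radius M < 1 \<longleftrightarrow> schur_stable M"
proof -
  let ?E = "eigenvalues (cmatrix M)"
  have "spectral_radius M < 1 \<longleftrightarrow> (\<forall>l\<in>?E. cmod l < 1)"
    unfolding spectral_radius_def
    using finite_eigenvalues_complex[of "cmatrix M"] eigenvalues_nonempty_complex[of "cmatrix M"]
    by (subst Max_less_iff) auto
  also have "\<dots> \<longleftrightarrow> schur_stable M"
  proof
    assume E: "\<forall>l\<in>?E. cmod l < 1"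
    \<comment> \<open>Halfway between the largest modulus and 1, so that every eigenvalue is
      strictly below \<open>r\<close> and the decay is still geometric.\<close>
    define r where "r = (1 + Max (cmod ` ?E)) / 2"
    have fin: "finite (cmod ` ?E)" and ne: "cmod ` ?E \<noteq> {}"
      using finite_eigenvalues_complex[of "cmatrix M"] eigenvalues_nonempty_complex[of "cmatrix M"] by auto
    have "Max (cmod ` ?E) \<in> cmod ` ?E" using fin ne by simp
    then have m: "0 \<le> Max (cmod ` ?E)" "Max (cmod ` ?E) < 1" using E by auto
    have r: "0 < r" "r < 1" using m by (auto simp: r_def)
    have l: "cmod l < r" if "l \<in> ?E" for l
    proof -
      have "cmod l \<le> Max (cmod ` ?E)" using that fin by simp
      then show ?thesis using m unfolding r_def by simp
    qed
    show "schur_stable M"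
      unfolding schur_stable_def
    proof
      fix x
      obtain c where c: "c \<ge> 0"
        "\<And>t. norm (((*v) (cmatrix M) ^^ t) (\<chi> i. complex_of_real (x $ i))) \<le> c * r ^ t"
        using geometric_decay_complex[OF r(1) l] by blast
      have eq: "((*v) (cmatrix M) ^^ t) (\<chi> i. complex_of_real (x $ i))
          = (\<chi> i. complex_of_real (state M x t $ i))" for t
        by (induction t) (auto simp: state_Suc cmatrix_mult_of_real)
      have "norm (state M x t) \<le> c * r ^ t" for t
        using c(2)[of t] unfolding eq by (simp add: norm_vec_def)
      then have "(norm (state M x t))\<^sup>2 \<le> (c * r ^ t)\<^sup>2" for t by (intro power_mono) auto
      then have b: "norm ((norm (state M x t))\<^sup>2) \<le> c\<^sup>2 * (r\<^sup>2) ^ t" for t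
        by (simp add: power_mult_distrib power_mult[symmetric] mult.commute)
      have "summable (\<lambda>t. c\<^sup>2 * (r\<^sup>2) ^ t)"
        using r by (intro summable_mult summable_geometric) (auto simp: power_less_one_iff)
      then show "summable (\<lambda>t. (norm (state M x t))\<^sup>2)"
        by (rule summable_comparison_test') (rule b)
    qed
  next
    assume st: "schur_stable M"
    have lim: "(\<lambda>t. norm (state M x t)) \<longlonglongrightarrow> 0" for x
    proof -
      have "(\<lambda>t. (norm (state M x t))\<^sup>2) \<longlonglongrightarrow> 0"
        using st by (intro summable_LIMSEQ_zero) (simp add: schur_stable_def)
      from tendsto_real_sqrt[OF this] show ?thesis by simp
    qed
    show "\<forall>l\<in>?E. cmod l < 1"
    proof
      fix l assume "l \<in> ?E"
      then obtain v where v: "v \<noteq> 0" "cmatrix M *v v = l *s v" by (auto simp: eigenvalues_def)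
      \<comment> \<open>The matrix is real, so the real and imaginary parts of an eigenvector run
        along real trajectories, which tend to zero. The complex trajectory has norm |l|^t |v|, and
        a single t with |l|^t < 1 suffices.\<close>
      define a where "a = (\<chi> i. Re (v $ i))"
      define b where "b = (\<chi> i. Im (v $ i))"
      let ?w = "\<lambda>t. ((*v) (cmatrix M) ^^ t) v"
      have re: "(\<chi> i. Re (?w t $ i)) = state M a t" for t
        by (induction t) (auto simp: a_def state_Suc Re_cmatrix_mult)
      have im: "(\<chi> i. Im (?w t $ i)) = state M b t" for t
        by (induction t) (auto simp: b_def state_Suc Im_cmatrix_mult)
      have split: "norm x \<le> norm (\<chi> i. Re (x $ i)) + norm (\<chi> i. Im (x $ i))" for x :: "complex^'n"
      proof -
        have "norm x \<le> L2_set (\<lambda>i. \<bar>Re (x $ i)\<bar> + \<bar>Im (x $ i)\<bar>) UNIV"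
          unfolding norm_vec_def by (intro L2_set_mono) (auto simp: cmod_le)
        also have "\<dots> \<le> L2_set (\<lambda>i. \<bar>Re (x $ i)\<bar>) UNIV + L2_set (\<lambda>i. \<bar>Im (x $ i)\<bar>) UNIV"
          by (rule L2_set_triangle_ineq)
        finally show ?thesis by (simp add: norm_vec_def)
      qed
      have nw: "norm (?w t) = cmod l ^ t * norm v" for t
        unfolding funpow_eigenvector[OF v(2)]
        by (simp add: norm_vec_def norm_mult norm_power L2_set_right_distrib)
      have "(\<lambda>t. norm (state M a t) + norm (state M b t)) \<longlonglongrightarrow> 0 + 0"
        by (intro tendsto_add lim)
      then have "\<forall>\<^sub>F t in sequentially. norm (state M a t) + norm (state M b t) < norm v"
        using v(1) by (intro order_tendstoD(2)[where y=0]) auto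
      then obtain t where "norm (state M a t) + norm (state M b t) < norm v"
        by (auto simp: eventually_sequentially)
      with split[of "?w t"] have "cmod l ^ t * norm v < 1 * norm v" unfolding nw re im by simp
      then have "cmod l ^ t < 1" using v(1) by (simp add: mult_less_cancel_right)
      then show "cmod l < 1" using one_le_power[of "cmod l" t] by linarith
    qed
  qed
  finally show ?thesis .
qed

section \<open>The discrete Lyapunov operator\<close>

lemma inner_matrix: "(X :: real^'n^'m) \<bullet> Y = (\<Sum>i\<in>UNIV. \<Sum>j\<in>UNIV. X $ i $ j * Y $ i $ j)"
  by (simp add: inner_vec_def)

lemma inner_transpose: "transpose X \<bullet> transpose Y = X \<bullet> (Y :: real^'n^'m)"
  unfolding inner_matrix by (subst sum.swap) (simp add: transpose_def)

text \<open>Cyclicity of the trace. With its right-hand twin it moves factors across the inner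
  product in the later trace identities.\<close>

lemma inner_matrix_mult_left:
  fixes M :: "real^'k^'m"
  shows "(M ** X) \<bullet> Y = X \<bullet> (transpose M ** Y)"
proof -
  let ?f = "\<lambda>i j k. M $ i $ k * (X $ k $ j * Y $ i $ j)"
  have "(M ** X) \<bullet> Y = (\<Sum>i\<in>UNIV. \<Sum>j\<in>UNIV. \<Sum>k\<in>UNIV. ?f i j k)"
    by (simp add: inner_matrix matrix_matrix_mult_def sum_distrib_right mult.assoc)
  also have "\<dots> = (\<Sum>i\<in>UNIV. \<Sum>k\<in>UNIV. \<Sum>j\<in>UNIV. ?f i j k)"
    by (rule sum.cong[OF refl], rule sum.swap)
  also have "\<dots> = (\<Sum>k\<in>UNIV. \<Sum>i\<in>UNIV. \<Sum>j\<in>UNIV. ?f i j k)"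
    by (rule sum.swap)
  also have "\<dots> = (\<Sum>k\<in>UNIV. \<Sum>j\<in>UNIV. \<Sum>i\<in>UNIV. ?f i j k)"
    by (rule sum.cong[OF refl], rule sum.swap)
  also have "\<dots> = X \<bullet> (transpose M ** Y)"
    by (simp add: inner_matrix matrix_matrix_mult_def transpose_def sum_distrib_left mult.left_commute)
  finally show ?thesis .
qed

lemma inner_matrix_mult_right:
  fixes M :: "real^'k^'m"
  shows "(X ** M) \<bullet> Y = X \<bullet> (Y ** transpose M)"
proof -
  have "(X ** M) \<bullet> Y = (transpose M ** transpose X) \<bullet> transpose Y"
    by (simp add: inner_transpose flip: matrix_transpose_mul)
  also have "\<dots> = transpose X \<bullet> transpose (Y ** transpose M)"
    by (simp add: inner_matrix_mult_left matrix_transpose_mul)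
  finally show ?thesis by (simp only: inner_transpose)
qed

lemma norm_transpose: "norm (transpose X) = norm (X :: real^'n^'m)"
  by (simp add: norm_eq_sqrt_inner inner_transpose)

lemma norm_matrix_vector_mult_le: "norm (X *v x) \<le> norm (X :: real^'n^'m) * norm x"
proof -
  have "norm (X *v x) \<le> L2_set (\<lambda>i. norm (X $ i) * norm x) UNIV"
    unfolding norm_vec_def[of "X *v x"]
    by (intro L2_set_mono) (auto simp: matrix_mult_dot Cauchy_Schwarz_ineq2)
  also have "\<dots> = norm X * norm x"
    by (simp add: norm_vec_def[of X] L2_set_left_distrib)
  finally show ?thesis .
qed

lemma norm_matrix_mult_le: "norm (X ** Y) \<le> norm (X :: real^'n^'m) * norm (Y :: real^'k^'n)"
proof -
  have row: "(X ** Y) $ i = transpose Y *v (X $ i)" for i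
    by (simp add: vec_eq_iff matrix_matrix_mult_def matrix_vector_mult_def transpose_def mult.commute)
  have le: "norm (transpose Y *v x) \<le> norm x * norm Y" for x
    using norm_matrix_vector_mult_le[of "transpose Y" x] by (simp add: norm_transpose mult.commute)
  have "norm (X ** Y) \<le> L2_set (\<lambda>i. norm (X $ i) * norm Y) UNIV"
    unfolding norm_vec_def[of "X ** Y"] row
    by (intro L2_set_mono le) auto
  also have "\<dots> = norm X * norm Y"
    by (simp add: norm_vec_def[of X] L2_set_left_distrib)
  finally show ?thesis .
qed

lemma matrix_add_rdistrib: "(X + Y) ** Z = X ** Z + Y ** (Z :: real^'k^'n)"
  by (simp add: vec_eq_iff matrix_matrix_mult_def algebra_simps sum.distrib)

lemma matrix_diff_rdistrib: "(X - Y) ** Z = X ** Z - Y ** (Z :: real^'k^'n)"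
  by (simp add: vec_eq_iff matrix_matrix_mult_def algebra_simps sum_subtractf)

lemma matrix_diff_ldistrib: "Z ** (X - Y) = Z ** X - Z ** (Y :: real^'k^'n)"
  by (simp add: vec_eq_iff matrix_matrix_mult_def algebra_simps sum_subtractf)

lemma transpose_add: "transpose (X + Y) = transpose X + transpose (Y :: real^'k^'n)"
  and transpose_diff: "transpose (X - Y) = transpose X - transpose (Y :: real^'k^'n)"
  and transpose_minus: "transpose (- X) = - transpose (X :: real^'k^'n)"
  by (simp_all add: vec_eq_iff transpose_def)

lemma bounded_bilinear_matrix_mult:
  "bounded_bilinear ((**) :: real^'n^'m \<Rightarrow> real^'k^'n \<Rightarrow> real^'k^'m)"
proof
  show "\<exists>K. \<forall>a b. norm (a ** b) \<le> norm (a::real^'n^'m) * norm (b::real^'k^'n) * K"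
    by (intro exI[of _ 1]) (simp add: norm_matrix_mult_le)
qed (simp_all add: vec_eq_iff matrix_matrix_mult_def sum.distrib sum_distrib_left algebra_simps)

lemma bounded_linear_transpose: "bounded_linear (transpose :: real^'n^'m \<Rightarrow> real^'m^'n)"
  by (rule bounded_linear_intro[of _ 1]) (simp_all add: transpose_add transpose_scalar norm_transpose)

lemma inner_matrix_vector_left: "(M *v x) \<bullet> y = x \<bullet> (transpose M *v (y :: real^'m))"
  by (metis dot_lmul_matrix inner_commute transpose_matrix_vector)

section \<open>Rank-one matrices\<close>

definition dyad :: "real^'n \<Rightarrow> real^'m \<Rightarrow> real^'m^'n" where
  "dyad u v = (\<chi> i j. u $ i * v $ j)"

lemma outer_eq_dyad: "outer x = dyad x x"
  by (simp add: outer_def dyad_def)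

lemma inner_dyad: "Y \<bullet> dyad u v = u \<bullet> (Y *v v)"
  unfolding inner_matrix dyad_def inner_vec_def matrix_vector_mult_def
  by (simp add: sum_distrib_left mult_ac)

lemma mult_dyad: "M ** dyad u v ** transpose N = dyad (M *v u) (N *v v)"
proof -
  have "M ** dyad u v = dyad (M *v u) v"
    by (simp add: vec_eq_iff matrix_matrix_mult_def dyad_def matrix_vector_mult_def
        sum_distrib_right mult.assoc)
  moreover have "dyad w v ** transpose N = dyad w (N *v v)" for w
    by (simp add: vec_eq_iff matrix_matrix_mult_def dyad_def matrix_vector_mult_def transpose_def
        sum_distrib_left mult_ac)
  ultimately show ?thesis by simp
qed

lemma dyad_vector_mult: "dyad u v *v x = (v \<bullet> x) *\<^sub>R u"
  by (simp add: vec_eq_iff dyad_def matrix_vector_mult_def inner_vec_def sum_distrib_left mult_ac)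

lemma norm_dyad: "norm (dyad u v) = norm u * norm v"
proof -
  have "dyad u v \<bullet> dyad u v = (u \<bullet> u) * (v \<bullet> v)"
    by (simp add: inner_dyad dyad_vector_mult)
  then show ?thesis by (simp add: norm_eq_sqrt_inner real_sqrt_mult)
qed

text \<open>Reduces claims about linear maps on matrices to rank-one matrices, where iterated
  congruences are pairs of trajectories.\<close>

lemma matrix_sum_dyad:
  "X = (\<Sum>i\<in>UNIV. \<Sum>j\<in>UNIV. X $ i $ j *\<^sub>R dyad (axis i 1) (axis j 1))" for X :: "real^'n^'m"
proof -
  have *: "X $ k $ l = (\<Sum>i\<in>UNIV. \<Sum>j\<in>UNIV. X $ i $ j * (axis i 1 $ k * axis j 1 $ l))" for k l
  proof -
    have "X $ i $ j * (axis i 1 $ k * axis j 1 $ l)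
        = (if j = l then if i = k then X $ k $ l else 0 else 0)" for i j
      by (simp add: axis_def)
    then show ?thesis by simp
  qed
  show ?thesis
    unfolding vec_eq_iff sum_component vector_scaleR_component dyad_def vec_lambda_beta real_scaleR_def
    by (intro allI) (rule *)
qed

section \<open>Congruences and the discrete Lyapunov series\<close>

definition congr :: "real^'n^'n \<Rightarrow> real^'n^'n \<Rightarrow> real^'n^'n" where
  "congr M X = M ** X ** transpose M"

lemma bounded_linear_congr: "bounded_linear (congr M)"
  using bounded_linear_compose[OF
      bounded_bilinear.bounded_linear_left[OF bounded_bilinear_matrix_mult, of "transpose M"]
      bounded_bilinear.bounded_linear_right[OF bounded_bilinear_matrix_mult, of M]]
  by (simp add: congr_def[abs_def])

lemmas linear_congr = bounded_linear_congr[THEN bounded_linear.linear]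

lemma linear_funpow: "linear f \<Longrightarrow> linear (f ^^ t)" for f :: "'a::real_vector \<Rightarrow> 'a"
  by (induction t) (auto simp: linear_iff)

lemma transpose_congr: "transpose (congr M X) = congr M (transpose X)"
  by (simp add: congr_def matrix_transpose_mul matrix_mul_assoc)

lemma inner_congr: "congr M X \<bullet> Y = X \<bullet> congr (transpose M) Y"
  by (simp only: congr_def inner_matrix_mult_right[of "M ** X" "transpose M"]
      inner_matrix_mult_left[of M X] matrix_mul_assoc transpose_transpose)

lemma quadratic_congr: "x \<bullet> (congr M X *v x) = (transpose M *v x) \<bullet> (X *v (transpose M *v x))"
  unfolding congr_def
  by (metis inner_matrix_vector_left inner_commute matrix_vector_mul_assoc)

lemma inner_congr_funpow: "(congr M ^^ t) X \<bullet> Y = X \<bullet> (congr (transpose M) ^^ t) Y"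
  by (induction t arbitrary: X Y) (auto simp: inner_congr funpow_swap1)

lemma congr_funpow_dyad: "(congr M ^^ t) (dyad u v) = dyad (state M u t) (state M v t)"
  by (induction t) (auto simp: congr_def mult_dyad state_Suc)

text \<open>The series solution of Y = X + M Y M^T. At the second moment of the initial state it is
  the state correlation; with \<open>transpose M\<close> and the stage cost it is the cost-to-go
  matrix.\<close>

definition lyap :: "real^'n^'n \<Rightarrow> real^'n^'n \<Rightarrow> real^'n^'n" where
  "lyap M X = (\<Sum>t. (congr M ^^ t) X)"

text \<open>On a dyad the terms are dyads of trajectories, with norm |M^t u| |M^t v|, which is at
  most the sum of the squares; linearity extends this to all matrices.\<close>

lemma summable_congr:
  assumes "schur_stable M"
  shows "summable (\<lambda>t. (congr M ^^ t) X)"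
proof -
  have *: "summable (\<lambda>t. (congr M ^^ t) (dyad u v))" for u v
  proof (rule summable_comparison_test')
    show "summable (\<lambda>t. (norm (state M u t))\<^sup>2 + (norm (state M v t))\<^sup>2)"
      using assms by (auto simp: schur_stable_def intro: summable_add)
    show "norm ((congr M ^^ t) (dyad u v)) \<le> (norm (state M u t))\<^sup>2 + (norm (state M v t))\<^sup>2"
      for t
    proof -
      have "0 \<le> norm (state M u t) * norm (state M v t)" by simp
      with sum_squares_bound[of "norm (state M u t)" "norm (state M v t)"] show ?thesis
        unfolding congr_funpow_dyad norm_dyad mult.assoc by linarith
    qed
  qed
  have "(congr M ^^ t) X = (\<Sum>i\<in>UNIV. \<Sum>j\<in>UNIV. X $ i $ j *\<^sub>R (congr M ^^ t) (dyad (axis i 1) (axis j 1)))" for t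
    by (subst matrix_sum_dyad[of X])
      (simp add: linear_sum[OF linear_funpow[OF linear_congr]] linear_cmul[OF linear_funpow[OF linear_congr]])
  then show ?thesis by (simp add: summable_sum summable_scaleR_right *)
qed

context
  fixes M :: "real^'n^'n"
  assumes M: "schur_stable M"
begin

lemma linear_lyap: "linear (lyap M)"
  unfolding lyap_def
  by (rule linearI)
    (simp_all add: suminf_add[OF summable_congr[OF M] summable_congr[OF M]]
      suminf_scaleR_right[OF summable_congr[OF M]]
      linear_add[OF linear_funpow[OF linear_congr]] linear_cmul[OF linear_funpow[OF linear_congr]])

lemmas bounded_linear_lyap = linear_lyap[THEN linear_conv_bounded_linear[THEN iffD1]]

lemma congr_lyap: "congr M (lyap M X) = lyap M (congr M X)"
  unfolding lyap_def bounded_linear.suminf[OF bounded_linear_congr summable_congr[OF M]]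
  by (simp add: funpow_swap1)

lemma lyap_eq: "lyap M X = X + congr M (lyap M X)"
proof -
  have "lyap M X = (congr M ^^ 0) X + (\<Sum>t. (congr M ^^ Suc t) X)"
    unfolding lyap_def using suminf_split_head[OF summable_congr[OF M], of X] by simp
  then have "lyap M X = X + lyap M (congr M X)" by (simp add: lyap_def funpow_swap1)
  then show ?thesis unfolding congr_lyap .
qed

text \<open>Uniqueness of the Lyapunov solution: whatever solves S = X + M S M^T is
  \<open>lyap M X\<close>. It serves to rewrite a given matrix as a value of
  \<open>lyap M\<close>.\<close>

lemma lyap_unique: "lyap M (S - congr M S) = S"
  using lyap_eq[of S] by (simp add: linear_diff[OF linear_lyap] congr_lyap)

lemma transpose_lyap: "transpose (lyap M X) = lyap M (transpose X)"
proof -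
  have "transpose ((congr M ^^ t) X) = (congr M ^^ t) (transpose X)" for t
    by (induction t) (auto simp: transpose_congr)
  then show ?thesis
    unfolding lyap_def bounded_linear.suminf[OF bounded_linear_transpose summable_congr[OF M]] by simp
qed

text \<open>|(M^T)^t x|^2 is the inner product of M^t (M^T)^t with x x^T, hence a term of the
  convergent series for the identity matrix.\<close>

lemma schur_stable_transpose: "schur_stable (transpose M)"
  unfolding schur_stable_def
proof
  fix x
  have "(norm (state (transpose M) x t))\<^sup>2 = (congr M ^^ t) (mat 1) \<bullet> dyad x x" for t
    unfolding inner_congr_funpow congr_funpow_dyad
    by (simp add: inner_dyad power2_norm_eq_inner)
  then show "summable (\<lambda>t. (norm (state (transpose M) x t))\<^sup>2)"
    using bounded_linear.summable[OF bounded_linear_inner_left summable_congr[OF M]] by simp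
qed

end

text \<open>Termwise adjointness of congruences. This duality lets the cost be read as X0 against
  \<open>P\<close> or as \<open>S\<close> against the stage cost.\<close>

lemma inner_lyap:
  assumes "schur_stable M"
  shows "lyap M X \<bullet> Y = X \<bullet> lyap (transpose M) Y"
  unfolding lyap_def
    bounded_linear.suminf[OF bounded_linear_inner_left summable_congr[OF assms]]
    bounded_linear.suminf[OF bounded_linear_inner_right summable_congr[OF schur_stable_transpose[OF assms]]]
  by (simp add: inner_congr_funpow)

text \<open>Only the quadratic form counts; symmetry is a separate hypothesis wherever it
  matters.\<close>

definition psd :: "real^'n^'n \<Rightarrow> bool" where
  "psd X \<longleftrightarrow> (\<forall>x. 0 \<le> x \<bullet> (X *v x))"

lemma psdD: "psd X \<Longrightarrow> 0 \<le> x \<bullet> (X *v x)"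
  by (simp add: psd_def)

lemma psd_congr: "psd X \<Longrightarrow> psd (congr M X)"
  by (simp add: psd_def quadratic_congr)

lemma quadratic_lyap_sums:
  assumes "schur_stable M"
  shows "(\<lambda>t. x \<bullet> ((congr M ^^ t) X *v x)) sums (x \<bullet> (lyap M X *v x))"
  using bounded_linear.sums[OF bounded_linear_inner_left summable_sums[OF summable_congr[OF assms]], of X "dyad x x"]
  by (simp add: inner_dyad lyap_def)

lemma psd_lyap:
  assumes "schur_stable M" "psd X"
  shows "psd (lyap M X)"
proof -
  have "psd ((congr M ^^ t) X)" for t
    by (induction t) (auto simp: assms psd_congr)
  then show ?thesis
    using sums_le[OF _ sums_zero quadratic_lyap_sums[OF assms(1)]] by (auto simp: psd_def)
qed

lemma psd_lyap_diff:
  assumes "schur_stable M" "psd X"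
  shows "psd (lyap M X - X)"
  using lyap_eq[OF assms(1), of X] psd_congr[OF psd_lyap[OF assms]] by (metis add_diff_cancel_left')

section \<open>Lyapunov functions as certificates of stability\<close>

lemma state_sum_bound:
  assumes "psd P" "\<And>x. \<epsilon> * (norm x)\<^sup>2 + (M *v x) \<bullet> (P *v (M *v x)) \<le> x \<bullet> (P *v x)"
  shows "\<epsilon> * (\<Sum>t<N. (norm (state M x t))\<^sup>2) \<le> x \<bullet> (P *v x)"
proof -
  \<comment> \<open>The dissipation inequality telescopes and leaves a nonnegative last term. The
    resulting bound depends on \<open>M\<close> only through \<open>P\<close>, so it can be uniform
    over many matrices.\<close>
  have "\<epsilon> * (\<Sum>t<N. (norm (state M x t))\<^sup>2) + state M x N \<bullet> (P *v state M x N) \<le> x \<bullet> (P *v x)"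
  proof (induction N)
    case (Suc N)
    then show ?case using assms(2)[of "state M x N"] by (simp add: state_Suc algebra_simps)
  qed simp
  then show ?thesis using psdD[OF assms(1), of "state M x N"] by linarith
qed

lemma schur_stable_bounded:
  assumes "\<And>x N. (\<Sum>t<N. (norm (state M x t))\<^sup>2) \<le> c x"
  shows "schur_stable M"
  unfolding schur_stable_def using assms by (blast intro: summableI_nonneg_bounded zero_le_power2)

lemma schur_stable_lyapunov:
  assumes "0 < \<epsilon>" "psd P" "\<And>x. \<epsilon> * (norm x)\<^sup>2 + (M *v x) \<bullet> (P *v (M *v x)) \<le> x \<bullet> (P *v x)"
  shows "schur_stable M"
proof (rule schur_stable_bounded)
  fix x N
  show "(\<Sum>t<N. (norm (state M x t))\<^sup>2) \<le> x \<bullet> (P *v x) / \<epsilon>"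
    using state_sum_bound[OF assms(2,3), where N = N and x = x] assms(1) by (simp add: pos_le_divide_eq mult.commute)
qed

lemma quadratic_le_norm: "\<bar>x \<bullet> (X *v x)\<bar> \<le> norm X * (norm x)\<^sup>2" for X :: "real^'n^'n"
proof -
  have "\<bar>x \<bullet> (X *v x)\<bar> \<le> norm x * norm (X *v x)" by (rule Cauchy_Schwarz_ineq2)
  also have "\<dots> \<le> norm x * (norm X * norm x)"
    by (intro mult_left_mono norm_matrix_vector_mult_le) auto
  finally show ?thesis by (simp add: power2_eq_square mult_ac)
qed

lemmas continuous_matrix_mult = bounded_bilinear.continuous[OF bounded_bilinear_matrix_mult]
lemmas continuous_transpose = bounded_linear.continuous[OF bounded_linear_transpose]

lemma continuous_congr:
  assumes "continuous F M" "continuous F X"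
  shows "continuous F (\<lambda>y. congr (M y) (X y))"
  unfolding congr_def by (intro continuous_matrix_mult continuous_transpose assms)

lemma psd_mat_1: "psd (mat 1 :: real^'n^'n)"
  by (simp add: psd_def)

text \<open>One Lyapunov function serves all nearby matrices: for \<open>M\<close> it dissipates
  |x|^2 per step, and a small perturbation uses up at most half of that.\<close>

lemma eventually_schur_stable:
  assumes "schur_stable M"
  shows "\<forall>\<^sub>F M' in nhds M. schur_stable M'"
proof -
  define P where "P = lyap (transpose M) (mat 1)"
  have st: "schur_stable (transpose M)" using schur_stable_transpose[OF assms] .
  have P: "psd P" unfolding P_def by (rule psd_lyap[OF st psd_mat_1])
  let ?f = "\<lambda>M'. congr (transpose M') P"
  have "isCont ?f M"
    by (intro continuous_congr continuous_transpose continuous_ident continuous_const)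
  then have "(?f \<longlongrightarrow> ?f M) (nhds M)" by (simp add: isCont_def tendsto_nhds_iff)
  then have "\<forall>\<^sub>F M' in nhds M. dist (?f M') (?f M) < 1 / 2" by (rule tendstoD) simp
  then show ?thesis
  proof (rule eventually_mono)
    fix M' assume d: "dist (?f M') (?f M) < 1 / 2"
    show "schur_stable M'"
    proof (rule schur_stable_lyapunov[of "1/2" P])
      fix x
      have "x \<bullet> (P *v x) = x \<bullet> ((mat 1 + ?f M) *v x)"
        using lyap_eq[OF st, of "mat 1"] by (simp add: P_def)
      then have e: "x \<bullet> (P *v x) = (norm x)\<^sup>2 + x \<bullet> (?f M *v x)"
        by (simp add: matrix_vector_mult_add_rdistrib inner_add_right power2_norm_eq_inner)
      have "x \<bullet> (?f M' *v x) - x \<bullet> (?f M *v x) \<le> norm (?f M' - ?f M) * (norm x)\<^sup>2"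
        using quadratic_le_norm[of x "?f M' - ?f M"]
        by (simp add: matrix_vector_mult_diff_rdistrib inner_diff_right)
      also have "\<dots> \<le> 1/2 * (norm x)\<^sup>2"
        using d by (intro mult_right_mono) (auto simp: dist_norm)
      finally show "1 / 2 * (norm x)\<^sup>2 + (M' *v x) \<bullet> (P *v (M' *v x)) \<le> x \<bullet> (P *v x)"
        using e by (simp add: quadratic_congr)
    qed (use P in auto)
  qed
qed

section \<open>Continuity and differentiability of the Lyapunov solution\<close>

lemma congr_diff:
  "congr M' S - congr M S = (M' - M) ** S ** transpose M' + M ** S ** transpose (M' - M)"
  by (simp add: congr_def matrix_diff_rdistrib transpose_diff matrix_diff_ldistrib)

text \<open>The solution for \<open>M'\<close> also stands on the right, but there the operator is
  the fixed \<open>lyap M\<close> and the correction is small when \<open>M'\<close> is near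
  \<open>M\<close>. Continuity and the derivative both come from this resolvent-type
  identity.\<close>

lemma lyap_perturb:
  assumes "schur_stable M" "schur_stable M'"
  shows "lyap M' X = lyap M (X + (congr M' (lyap M' X) - congr M (lyap M' X)))"
  using lyap_unique[OF assms(1), of "lyap M' X"] lyap_eq[OF assms(2), of X]
  by (simp add: algebra_simps)

lemma norm_congr_diff:
  "norm (congr M' S - congr M S) \<le> norm (M' - M) * (norm M' + norm M) * norm S"
proof -
  have "norm ((M' - M) ** S ** transpose M') \<le> norm (M' - M) * norm S * norm M'"
    using norm_matrix_mult_le[of "(M' - M) ** S" "transpose M'"]
      mult_right_mono[OF norm_matrix_mult_le[of "M' - M" S], of "norm M'"]
    by (simp add: norm_transpose)
  moreover have "norm (M ** S ** transpose (M' - M)) \<le> norm M * norm S * norm (M' - M)"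
    using norm_matrix_mult_le[of "M ** S" "transpose (M' - M)"]
      mult_right_mono[OF norm_matrix_mult_le[of M S], of "norm (M' - M)"]
    by (simp add: norm_transpose)
  ultimately show ?thesis
    unfolding congr_diff
    using norm_triangle_ineq[of "(M' - M) ** S ** transpose M'" "M ** S ** transpose (M' - M)"]
    by (simp add: algebra_simps)
qed

lemma isCont_lyap:
  fixes F X :: "'a::t2_space \<Rightarrow> real^'n^'n"
  assumes F: "isCont F x" and X: "isCont X x" and st: "schur_stable (F x)"
  shows "isCont (\<lambda>y. lyap (F y) (X y)) x"
proof -
  obtain c where c: "c > 0" "\<And>Y. norm (lyap (F x) Y) \<le> norm Y * c"
    using bounded_linear.pos_bounded[OF bounded_linear_lyap[OF st]] by blast
  define \<delta> where "\<delta> y = norm (F y - F x) * (norm (F y) + norm (F x))" for y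
  have d: "(\<delta> \<longlongrightarrow> 0) (at x)"
  proof -
    have "(\<delta> \<longlongrightarrow> norm (F x - F x) * (norm (F x) + norm (F x))) (at x)"
      unfolding \<delta>_def by (intro tendsto_intros F[unfolded isCont_def])
    then show ?thesis by simp
  qed
  have st': "\<forall>\<^sub>F y in at x. schur_stable (F y)"
    by (rule eventually_compose_filterlim[OF eventually_schur_stable[OF st] F[unfolded isCont_def]])
  \<comment> \<open>Below this threshold the correction contributes at most half of
    \<open>norm ?S\<close>, which is absorbed on the left and leaves the factor 2.\<close>
  have "\<forall>\<^sub>F y in at x. \<delta> y < 1 / (2 * c)" by (rule order_tendstoD(2)[OF d]) (use c in simp)
  then have "\<forall>\<^sub>F y in at x. norm (lyap (F y) (X y) - lyap (F x) (X x))
      \<le> (norm (X y - X x) + \<delta> y * (2 * c * norm (X y))) * c"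
    using st'
  proof eventually_elim
    case (elim y)
    let ?S = "lyap (F y) (X y)"
    let ?D = "congr (F y) ?S - congr (F x) ?S"
    have S: "?S = lyap (F x) (X y + ?D)" by (rule lyap_perturb[OF st elim(2)])
    have D: "norm ?D \<le> \<delta> y * norm ?S" unfolding \<delta>_def by (rule norm_congr_diff)
    have "norm ?S \<le> norm (X y + ?D) * c" by (subst S) (rule c)
    also have "\<dots> \<le> (norm (X y) + \<delta> y * norm ?S) * c"
      using D norm_triangle_ineq[of "X y" ?D] c(1) by (intro mult_right_mono) auto
    also have "\<dots> \<le> (norm (X y) + (1 / (2 * c)) * norm ?S) * c"
      using elim(1) c(1) by (intro mult_right_mono add_left_mono) auto
    also have "\<dots> = norm (X y) * c + (1 / (2 * c)) * norm ?S * c" by (rule distrib_right)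
    also have "(1 / (2 * c)) * norm ?S * c = norm ?S / 2" using c(1) by simp
    finally have b: "norm ?S \<le> 2 * c * norm (X y)" by (simp add: mult_ac)
    have "?S - lyap (F x) (X x) = lyap (F x) (X y + ?D) - lyap (F x) (X x)"
      by (rule arg_cong[OF S])
    also have "\<dots> = lyap (F x) (X y + ?D - X x)"
      by (rule linear_diff[OF linear_lyap[OF st], symmetric])
    also have "X y + ?D - X x = X y - X x + ?D" by simp
    finally have "?S - lyap (F x) (X x) = lyap (F x) (X y - X x + ?D)" .
    then have "norm (?S - lyap (F x) (X x)) \<le> norm (X y - X x + ?D) * c" using c(2) by simp
    also have "\<dots> \<le> (norm (X y - X x) + \<delta> y * (2 * c * norm (X y))) * c"
    proof (intro mult_right_mono)
      have "0 \<le> \<delta> y" by (simp add: \<delta>_def)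
      then have "norm ?D \<le> \<delta> y * (2 * c * norm (X y))"
        using D mult_left_mono[OF b] by (meson order_trans)
      then show "norm (X y - X x + ?D) \<le> norm (X y - X x) + \<delta> y * (2 * c * norm (X y))"
        using norm_triangle_ineq[of "X y - X x" ?D] by linarith
    qed (use c in simp)
    finally show ?case .
  qed
  moreover have "((\<lambda>y. (norm (X y - X x) + \<delta> y * (2 * c * norm (X y))) * c)
      \<longlongrightarrow> (norm (X x - X x) + 0 * (2 * c * norm (X x))) * c) (at x)"
    by (intro tendsto_intros d X[unfolded isCont_def])
  then have "((\<lambda>y. (norm (X y - X x) + \<delta> y * (2 * c * norm (X y))) * c) \<longlongrightarrow> 0) (at x)" by simp
  ultimately have "((\<lambda>y. lyap (F y) (X y) - lyap (F x) (X x)) \<longlongrightarrow> 0) (at x)"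
    by (rule Lim_null_comparison)
  then show ?thesis unfolding isCont_def by (rule LIM_zero_cancel)
qed

text \<open>A product rule in which one factor vanishes at the point and the other is merely
  continuous. In \<open>has_derivative_lyap\<close> the second factor contains the Lyapunov
  solution, whose differentiability is still to be shown.\<close>

lemma has_derivative_bilinear_continuous:
  fixes f :: "'a::real_normed_vector \<Rightarrow> 'b::real_normed_vector" and g :: "'a \<Rightarrow> 'c::real_normed_vector"
  assumes "bounded_bilinear p" and f: "(f has_derivative f') (at x)" and "f x = 0"
    and g: "isCont g x"
  shows "((\<lambda>y. p (f y) (g y)) has_derivative (\<lambda>h. p (f' h) (g x))) (at x)"
proof -
  interpret p: bounded_bilinear p by fact
  obtain K where K: "K > 0" "\<And>a b. norm (p a b) \<le> norm a * norm b * K" using p.pos_bounded by blast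
  have 1: "((\<lambda>y. p (f y) (g x)) has_derivative (\<lambda>h. p (f' h) (g x))) (at x)"
    by (rule bounded_linear.has_derivative[OF p.bounded_linear_left f])
  have "bounded_linear f'" using f has_derivative_bounded_linear by blast
  then obtain B where B: "\<And>h. norm (f' h) \<le> norm h * B" using bounded_linear.bounded by blast
  let ?r = "\<lambda>h. norm (f (x + h) - f x - f' h) / norm h"
  have r: "(?r \<longlongrightarrow> 0) (at 0)" using f by (simp add: has_derivative_at)
  have g': "((\<lambda>h. norm (g (x + h) - g x)) \<longlongrightarrow> 0) (at 0)"
    using g unfolding isCont_iff by (intro tendsto_norm_zero LIM_zero)
  \<comment> \<open>This remainder is o(h): \<open>f\<close> is O(h) because it vanishes at
    \<open>x\<close>, and the increment of \<open>g\<close> tends to zero.\<close>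
  have "((\<lambda>y. p (f y) (g y - g x)) has_derivative (\<lambda>h. 0)) (at x)"
    unfolding has_derivative_at
  proof
    have "\<forall>\<^sub>F h in at 0. norm (norm (p (f (x + h)) (g (x + h) - g x)) / norm h)
        \<le> (?r h + B) * norm (g (x + h) - g x) * K"
      unfolding eventually_at_filter
    proof (intro always_eventually allI impI)
      fix h :: 'a assume h: "h \<noteq> 0"
      have "norm (f (x + h)) \<le> norm (f (x + h) - f x - f' h) + norm (f' h)"
        using norm_triangle_ineq[of "f (x + h) - f x - f' h" "f' h"] assms(3) by simp
      also have "\<dots> \<le> (?r h + B) * norm h" using B[of h] h by (simp add: field_simps)
      finally have "norm (f (x + h)) * norm (g (x + h) - g x) * K
          \<le> (?r h + B) * norm h * norm (g (x + h) - g x) * K"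
        using K(1) by (intro mult_right_mono) auto
      with K(2)[of "f (x + h)" "g (x + h) - g x"]
      have "norm (p (f (x + h)) (g (x + h) - g x)) \<le> (?r h + B) * norm (g (x + h) - g x) * K * norm h"
        by (simp only: mult_ac)
      then have "norm (p (f (x + h)) (g (x + h) - g x)) / norm h
          \<le> (?r h + B) * norm (g (x + h) - g x) * K"
        using h by (intro mult_imp_div_pos_le) auto
      then show "norm (norm (p (f (x + h)) (g (x + h) - g x)) / norm h)
          \<le> (?r h + B) * norm (g (x + h) - g x) * K"
        unfolding real_norm_def abs_divide abs_norm_cancel .
    qed
    moreover have "((\<lambda>h. (?r h + B) * norm (g (x + h) - g x) * K) \<longlongrightarrow> (0 + B) * 0 * K) (at 0)"
      by (intro tendsto_intros r g')
    then have "((\<lambda>h. (?r h + B) * norm (g (x + h) - g x) * K) \<longlongrightarrow> 0) (at 0)"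
      by simp
    ultimately have "((\<lambda>h. norm (p (f (x + h)) (g (x + h) - g x)) / norm h) \<longlongrightarrow> 0) (at 0)"
      by (rule Lim_null_comparison)
    then show "(\<lambda>h. norm (p (f (x + h)) (g (x + h) - g x) - p (f x) (g x - g x) - 0) / norm h) \<midarrow>0\<rightarrow> 0"
      by (simp add: assms(3) p.zero_left)
  qed simp
  from has_derivative_add[OF 1 this] show ?thesis by (simp add: p.diff_right)
qed

lemma has_derivative_lyap:
  fixes F X :: "'a::real_normed_vector \<Rightarrow> real^'n^'n"
  assumes F: "(F has_derivative F') (at x)" and X: "(X has_derivative X') (at x)"
    and st: "schur_stable (F x)"
  defines "S \<equiv> lyap (F x) (X x)"
  shows "((\<lambda>y. lyap (F y) (X y)) has_derivative
    (\<lambda>h. lyap (F x) (X' h + (F' h ** S ** transpose (F x) + F x ** S ** transpose (F' h))))) (at x)"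
proof -
  let ?S = "\<lambda>y. lyap (F y) (X y)"
  have cF: "isCont F x" and cX: "isCont X x"
    using F X has_derivative_continuous by blast+
  have cS: "isCont ?S x" by (rule isCont_lyap[OF cF cX st])
  note bil = bounded_bilinear_matrix_mult
  have dF: "((\<lambda>y. F y - F x) has_derivative F') (at x)"
    using has_derivative_diff[OF F has_derivative_const] by simp
  have dFt: "((\<lambda>y. transpose (F y - F x)) has_derivative (\<lambda>h. transpose (F' h))) (at x)"
    by (rule bounded_linear.has_derivative[OF bounded_linear_transpose dF])
  have 1: "((\<lambda>y. (F y - F x) ** (?S y ** transpose (F y))) has_derivative
      (\<lambda>h. F' h ** (S ** transpose (F x)))) (at x)"
    unfolding S_def
    by (rule has_derivative_bilinear_continuous[OF bil dF])
      (simp_all add: continuous_matrix_mult continuous_transpose cF cS)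
  have 2: "((\<lambda>y. (F x ** ?S y) ** transpose (F y - F x)) has_derivative
      (\<lambda>h. (F x ** S) ** transpose (F' h))) (at x)"
    unfolding S_def
    by (rule has_derivative_bilinear_continuous[OF bounded_bilinear.flip[OF bil] dFt])
      (simp_all add: linear_0[OF bounded_linear.linear[OF bounded_linear_transpose]] continuous_matrix_mult cS)
  \<comment> \<open>\<open>?S\<close> occurs here only next to the factor F y - F x, which vanishes
    at \<open>x\<close>, so its continuity is enough to differentiate \<open>?H\<close>.\<close>
  let ?H = "\<lambda>y. X y + ((F y - F x) ** (?S y ** transpose (F y)) + (F x ** ?S y) ** transpose (F y - F x))"
  have H: "((\<lambda>y. lyap (F x) (?H y)) has_derivative
    (\<lambda>h. lyap (F x) (X' h + (F' h ** S ** transpose (F x) + F x ** S ** transpose (F' h))))) (at x)"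
    using bounded_linear.has_derivative[OF bounded_linear_lyap[OF st] has_derivative_add[OF X has_derivative_add[OF 1 2]]]
    by (simp add: matrix_mul_assoc)
  have "\<forall>\<^sub>F y in nhds x. schur_stable (F y)"
    by (rule eventually_compose_filterlim[OF eventually_schur_stable[OF st]])
      (use cF in \<open>simp add: isCont_def tendsto_nhds_iff\<close>)
  then have ev: "\<forall>\<^sub>F y in nhds x. lyap (F x) (?H y) = ?S y"
  proof (rule eventually_mono)
    fix y assume "schur_stable (F y)"
    from lyap_perturb[OF st this, of "X y"] show "lyap (F x) (?H y) = ?S y"
      by (simp add: congr_diff matrix_mul_assoc)
  qed
  show ?thesis
    by (rule has_derivative_transform_eventually[OF H])
      (use ev eventually_nhds_x_imp_x[OF ev] in \<open>auto simp: eventually_at_filter elim: eventually_mono\<close>)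
qed

section \<open>Positive semidefinite matrices and singular values\<close>

lemma quadratic_outer: "x \<bullet> (outer w *v x) = (w \<bullet> x)\<^sup>2"
  by (simp add: outer_eq_dyad dyad_vector_mult power2_eq_square inner_commute)

lemma transpose_outer: "transpose (outer w) = outer w"
  by (simp add: outer_def transpose_def vec_eq_iff mult.commute)

lemma inner_outer: "outer u \<bullet> Y = u \<bullet> (Y *v u)"
  by (simp add: outer_eq_dyad inner_dyad inner_commute[of "dyad u u"])

lemma sym_inner_commute:
  assumes "transpose X = X"
  shows "(X *v x) \<bullet> y = x \<bullet> (X *v (y :: real^'n))"
  by (simp add: inner_matrix_vector_left assms)

lemma scaleR_matrix_vector: "(c *\<^sub>R X) *v x = c *\<^sub>R (X *v (x :: real^'n))"
  by (simp add: scaleR_matrix_vector_assoc)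

lemma psd_Cauchy_Schwarz:
  fixes X :: "real^'n^'n"
  assumes "psd X" "transpose X = X"
  shows "(y \<bullet> (X *v x))\<^sup>2 \<le> (y \<bullet> (X *v y)) * (x \<bullet> (X *v x))"
proof -
  define a b c where "a = y \<bullet> (X *v y)" and "b = y \<bullet> (X *v x)" and "c = x \<bullet> (X *v x)"
  have b': "x \<bullet> (X *v y) = b"
    unfolding b_def by (metis sym_inner_commute[OF assms(2)] inner_commute)
  have q: "0 \<le> a + 2 * t * b + t\<^sup>2 * c" for t
  proof -
    have "(y + t *\<^sub>R x) \<bullet> (X *v (y + t *\<^sub>R x)) = a + 2 * t * b + t\<^sup>2 * c"
      by (simp add: matrix_vector_right_distrib matrix_vector_mult_scaleR inner_add_left
          inner_add_right b' a_def[symmetric] b_def[symmetric] c_def[symmetric] power2_eq_square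
          algebra_simps)
    then show ?thesis using psdD[OF assms(1), of "y + t *\<^sub>R x"] by simp
  qed
  have c0: "c \<ge> 0" using psdD[OF assms(1)] by (simp add: c_def)
  have "b\<^sup>2 \<le> a * c"
  proof (cases "c = 0")
    case True
    have "b = 0"
    proof (rule ccontr)
      assume "b \<noteq> 0"
      \<comment> \<open>For c = 0 the quadratic in t is affine, and this t gives it the value
        -1.\<close>
      with q[of "- (a + 1) / (2 * b)"] True show False by (simp add: field_simps)
    qed
    then show ?thesis using True by simp
  next
    case False
    then have "c > 0" using c0 by simp
    have "0 \<le> (a + 2 * (- b / c) * b + (- b / c)\<^sup>2 * c) * c"
      using q[of "- b / c"] c0 by (rule mult_nonneg_nonneg)
    also have "\<dots> = a * c - b\<^sup>2"
      using False by (simp add: field_simps power2_eq_square)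
    finally show ?thesis by simp
  qed
  then show ?thesis by (simp add: a_def b_def c_def)
qed

text \<open>Cauchy-Schwarz for the form of \<open>X\<close>, applied to \<open>X *v x\<close> and
  \<open>x\<close>, bounds |X x|^4 by zero.\<close>

lemma psd_kernel:
  fixes X :: "real^'n^'n"
  assumes "psd X" "transpose X = X" "x \<bullet> (X *v x) = 0"
  shows "X *v x = 0"
  using psd_Cauchy_Schwarz[OF assms(1,2), of "X *v x" x] assms(3) by simp

text \<open>Rank reduction: subtracting \<open>(X x) (X x)\<^sup>T / (x \<bullet> X x)\<close> keeps \<open>X\<close> positive semidefinite
  and adds \<open>x\<close> to its kernel.\<close>

lemma psd_eq_sum_outer:
  fixes X :: "real^'n^'n"
  assumes "psd X" "transpose X = X"
  shows "\<exists>u (m :: nat). X = (\<Sum>k<m. outer (u k))"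
  using assms
\<comment> \<open>The measure is the rank of \<open>X\<close>, written as the codimension of its
  kernel.\<close>
proof (induction "CARD('n) - dim {x. X *v x = 0}" arbitrary: X rule: less_induct)
  case less
  show ?case
  proof (cases "\<forall>x. x \<bullet> (X *v x) = 0")
    case True
    then have "X = 0" using psd_kernel[OF less.prems] by (simp add: matrix_eq)
    then show ?thesis by (intro exI[of _ undefined] exI[of _ "0::nat"]) simp
  next
    case False
    then obtain x where x: "x \<bullet> (X *v x) \<noteq> 0" by blast
    define q where "q = x \<bullet> (X *v x)"
    have q: "q > 0" using x psdD[OF less.prems(1), of x] by (simp add: q_def)
    define w where "w = X *v x"
    define X' where "X' = X - (1 / q) *\<^sub>R outer w"
    have X'v: "X' *v y = X *v y - ((w \<bullet> y) / q) *\<^sub>R w" for y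
      by (simp add: X'_def matrix_vector_mult_diff_rdistrib scaleR_matrix_vector outer_eq_dyad
          dyad_vector_mult)
    have sym: "transpose X' = X'"
      by (simp add: X'_def transpose_diff transpose_scalar transpose_outer less.prems(2))
    have psd: "psd X'"
      unfolding psd_def
    proof
      fix y
      have "(w \<bullet> y)\<^sup>2 / q \<le> y \<bullet> (X *v y)"
        using psd_Cauchy_Schwarz[OF less.prems, of y x] q
        by (simp add: pos_divide_le_eq w_def q_def inner_commute)
      then show "0 \<le> y \<bullet> (X' *v y)"
        by (simp add: X'v inner_diff_right power2_eq_square inner_commute[of y w])
    qed
    have sub: "subspace {x. Y *v x = 0}" for Y :: "real^'n^'n"
      by (auto simp: subspace_def matrix_vector_right_distrib matrix_vector_mult_scaleR)
    have "{x. X *v x = 0} \<subset> {x. X' *v x = 0}"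
    proof
      show "{x. X *v x = 0} \<subseteq> {x. X' *v x = 0}"
        using sym_inner_commute[OF less.prems(2), of x] by (auto simp: X'v w_def)
      have "w \<bullet> x = q" by (simp add: w_def q_def inner_commute)
      then have "X' *v x = 0" using q by (simp add: X'v flip: w_def)
      moreover have "X *v x \<noteq> 0" using x by auto
      ultimately show "{x. X *v x = 0} \<noteq> {x. X' *v x = 0}" by blast
    qed
    then have "dim {x. X *v x = 0} < dim {x. X' *v x = 0}"
      by (intro dim_psubset) (simp add: span_eq_iff[THEN iffD2, OF sub])
    moreover have "dim {x. X' *v x = 0} \<le> CARD('n)" by (rule dim_subset_UNIV_cart)
    ultimately have "CARD('n) - dim {x. X' *v x = 0} < CARD('n) - dim {x. X *v x = 0}" by simp
    from less.hyps[OF this psd sym] obtain u and m :: nat where um: "X' = (\<Sum>k<m. outer (u k))"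
      by blast
    define u' where "u' = u(m := (1 / sqrt q) *\<^sub>R w)"
    have "outer ((1 / sqrt q) *\<^sub>R w) = (1 / q) *\<^sub>R outer w"
      using q by (simp add: outer_def vec_eq_iff)
    then have "X = X' + outer ((1 / sqrt q) *\<^sub>R w)" by (simp add: X'_def)
    also have "\<dots> = (\<Sum>k<Suc m. outer (u' k))" by (simp add: um u'_def)
    finally show ?thesis by blast
  qed
qed

text \<open>A decomposition of \<open>X\<close> into outer products turns the inner product into a
  sum of values of the quadratic form of \<open>Y\<close>.\<close>

lemma inner_psd_nonneg:
  fixes X Y :: "real^'n^'n"
  assumes "psd X" "transpose X = X" "psd Y"
  shows "0 \<le> X \<bullet> Y"
proof -
  obtain u and m :: nat where "X = (\<Sum>k<m. outer (u k))" using psd_eq_sum_outer[OF assms(1,2)] by blast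
  then have "X \<bullet> Y = (\<Sum>k<m. u k \<bullet> (Y *v u k))" by (simp add: inner_sum_left inner_outer)
  then show ?thesis using psdD[OF assms(3)] by (simp add: sum_nonneg)
qed

lemma psd_diff_scaleR_mat_1:
  "psd (X - c *\<^sub>R mat 1) \<longleftrightarrow> (\<forall>x. c * (norm x)\<^sup>2 \<le> x \<bullet> (X *v x))"
  by (simp add: psd_def matrix_vector_mult_diff_rdistrib inner_diff_right scaleR_matrix_vector
      power2_norm_eq_inner)

lemma psd_scaleR_mat_1_diff:
  "psd (c *\<^sub>R mat 1 - X) \<longleftrightarrow> (\<forall>x. x \<bullet> (X *v x) \<le> c * (norm x)\<^sup>2)"
  by (simp add: psd_def matrix_vector_mult_diff_rdistrib inner_diff_right scaleR_matrix_vector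
      power2_norm_eq_inner)

text \<open>\<open>X \<bullet> mat 1\<close> is the trace of \<open>X\<close>. The matrix Y - c I is
  positive semidefinite, so its inner product with \<open>X\<close> is nonnegative.\<close>

lemma trace_inner_ge:
  fixes X Y :: "real^'n^'n"
  assumes "psd X" "transpose X = X" "\<And>x. c * (norm x)\<^sup>2 \<le> x \<bullet> (Y *v x)"
  shows "c * (X \<bullet> mat 1) \<le> X \<bullet> Y"
  using inner_psd_nonneg[OF assms(1,2), of "Y - c *\<^sub>R mat 1"] assms(3)
  by (simp add: psd_diff_scaleR_mat_1 inner_diff_right)

lemma trace_inner_le:
  fixes X Y :: "real^'n^'n"
  assumes "psd X" "transpose X = X" "\<And>x. x \<bullet> (Y *v x) \<le> c * (norm x)\<^sup>2"
  shows "X \<bullet> Y \<le> c * (X \<bullet> mat 1)"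
  using inner_psd_nonneg[OF assms(1,2), of "c *\<^sub>R mat 1 - Y"] assms(3)
  by (simp add: psd_scaleR_mat_1_diff inner_diff_right)

text \<open>The outer product x x^T is at most |x|^2 times the identity.\<close>

lemma quadratic_le_trace:
  fixes X :: "real^'n^'n"
  assumes "psd X" "transpose X = X"
  shows "x \<bullet> (X *v x) \<le> (X \<bullet> mat 1) * (norm x)\<^sup>2"
proof -
  have "y \<bullet> (outer x *v y) \<le> (norm x)\<^sup>2 * (norm y)\<^sup>2" for y
    using power_mono[OF Cauchy_Schwarz_ineq2[of x y], of 2]
    by (simp add: quadratic_outer power_mult_distrib)
  from trace_inner_le[OF assms this] show ?thesis
    by (simp add: inner_outer inner_commute[of X "outer x"] mult.commute)
qed

section \<open>Rayleigh quotients and the smallest singular value\<close>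

lemma rayleigh_minimum:
  fixes G :: "real^'n^'n"
  assumes "transpose G = G"
  obtains l v where "norm v = 1" "G *v v = l *\<^sub>R v" "\<And>x. l * (norm x)\<^sup>2 \<le> x \<bullet> (G *v x)"
proof -
  have "continuous_on (sphere 0 1) (\<lambda>x. x \<bullet> (G *v x))"
    by (intro continuous_intros linear_continuous_on matrix_vector_mul_bounded_linear)
  moreover have "sphere (0 :: real^'n) 1 \<noteq> {}" by simp
  ultimately obtain v where v: "v \<in> sphere 0 1" "\<And>x. x \<in> sphere 0 1 \<Longrightarrow> v \<bullet> (G *v v) \<le> x \<bullet> (G *v x)"
    using continuous_attains_inf[OF compact_sphere] by blast
  define l where "l = v \<bullet> (G *v v)"
  have min: "l * (norm x)\<^sup>2 \<le> x \<bullet> (G *v x)" for x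
  proof (cases "x = 0")
    case False
    then have "l \<le> ((1 / norm x) *\<^sub>R x) \<bullet> (G *v ((1 / norm x) *\<^sub>R x))"
      unfolding l_def by (intro v(2)) simp
    also have "\<dots> = x \<bullet> (G *v x) / (norm x)\<^sup>2"
      by (simp add: matrix_vector_mult_scaleR power2_eq_square)
    finally show ?thesis using False by (simp add: pos_le_divide_eq)
  qed simp
  \<comment> \<open>The minimizer is a zero of the semidefinite form of G - l I, so it lies in the
    kernel; this replaces a Lagrange multiplier argument.\<close>
  have "(G - l *\<^sub>R mat 1) *v v = 0"
  proof (rule psd_kernel)
    show "psd (G - l *\<^sub>R mat 1)" using min by (simp add: psd_diff_scaleR_mat_1)
    show "transpose (G - l *\<^sub>R mat 1) = G - l *\<^sub>R mat 1"
      by (simp add: transpose_diff transpose_scalar assms)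
    show "v \<bullet> ((G - l *\<^sub>R mat 1) *v v) = 0"
      using v(1) by (simp add: matrix_vector_mult_diff_rdistrib scaleR_matrix_vector inner_diff_right
          l_def power2_norm_eq_inner[symmetric])
  qed
  then have "G *v v = l *\<^sub>R v"
    by (simp add: matrix_vector_mult_diff_rdistrib scaleR_matrix_vector)
  from that[OF _ this min] v(1) show thesis by auto
qed

lemma finite_eigenvalues_real: "finite (eigenvalues (G :: real^'n^'n))"
proof -
  have "complex_of_real ` eigenvalues G \<subseteq> eigenvalues (cmatrix G)"
  proof (rule image_subsetI)
    fix l assume "l \<in> eigenvalues G"
    then obtain v where v: "v \<noteq> 0" "G *v v = l *s v" by (auto simp: eigenvalues_def)
    have "cmatrix G *v (\<chi> i. complex_of_real (v $ i)) = complex_of_real l *s (\<chi> i. complex_of_real (v $ i))"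
      by (simp add: cmatrix_mult_of_real v(2) vec_eq_iff)
    moreover have "(\<chi> i. complex_of_real (v $ i)) \<noteq> 0" using v(1) by (simp add: vec_eq_iff)
    ultimately show "complex_of_real l \<in> eigenvalues (cmatrix G)" by (auto simp: eigenvalues_def)
  qed
  then show ?thesis
    using finite_eigenvalues_complex finite_subset finite_imageD[of complex_of_real]
    by (metis inj_of_real inj_on_subset subset_UNIV)
qed

lemma sigma_min_le:
  fixes M :: "real^'c^'r"
  assumes "CARD('c) \<le> CARD('r)" "v \<noteq> 0" "(transpose M ** M) *v v = l *\<^sub>R v"
  shows "sigma_min M \<le> sqrt l"
  unfolding sigma_min_def singular_values_def
  using assms finite_eigenvalues_real[of "transpose M ** M"]
  by (intro Min_le) (auto simp: eigenvalues_def scalar_mult_eq_scaleR)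

lemma gram_quadratic: "x \<bullet> ((transpose M ** M) *v x) = (norm (M *v x))\<^sup>2" for M :: "real^'c^'r"
  by (metis inner_matrix_vector_left inner_commute matrix_vector_mul_assoc power2_norm_eq_inner)

lemma sigma_min_attained:
  fixes M :: "real^'c^'r"
  assumes "CARD('c) \<le> CARD('r)"
  obtains v where "v \<noteq> 0" "sigma_min M * norm v = norm (M *v v)" "0 \<le> sigma_min M"
    "\<And>x. sigma_min M * norm x \<le> norm (M *v x)"
proof -
  let ?G = "transpose M ** M"
  have "transpose ?G = ?G" by (simp add: matrix_transpose_mul)
  then obtain l w where l: "norm w = 1" "?G *v w = l *\<^sub>R w" "\<And>x. l * (norm x)\<^sup>2 \<le> x \<bullet> (?G *v x)"
    using rayleigh_minimum by blast
  have w0: "w \<noteq> 0" using l(1) by auto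
  have le: "sigma_min M \<le> sqrt l" using sigma_min_le[OF assms w0 l(2)] .
  \<comment> \<open>Two facts about the minimum are combined: it is at most the root of the Rayleigh
    value \<open>l\<close>, which gives the lower bound at every \<open>x\<close>, and it is itself
    the root of some eigenvalue \<open>k\<close>, which gives equality at an eigenvector.\<close>
  have "l \<in> eigenvalues ?G" using w0 l(2) by (auto simp: eigenvalues_def scalar_mult_eq_scaleR)
  then have "sigma_min M \<in> sqrt ` eigenvalues ?G"
    unfolding sigma_min_def singular_values_def using assms finite_eigenvalues_real[of ?G]
    by (auto intro: Min_in)
  then obtain k v where k: "sigma_min M = sqrt k" "v \<noteq> 0" "?G *v v = k *s v"
    by (auto simp: eigenvalues_def)
  have "(norm (M *v v))\<^sup>2 = k * (norm v)\<^sup>2"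
    unfolding gram_quadratic[symmetric] k(3)
    by (simp add: scalar_mult_eq_scaleR power2_norm_eq_inner)
  then have kv: "norm (M *v v) = sqrt k * norm v"
    by (metis real_sqrt_mult real_sqrt_abs abs_norm_cancel)
  \<comment> \<open>The real \<open>sqrt\<close> is odd, so the sign of \<open>sqrt k\<close> has to
    be read off from the norm.\<close>
  have "0 \<le> sqrt k * norm v" using kv by (metis norm_ge_zero)
  then have s0: "0 \<le> sigma_min M" using k by (simp add: zero_le_mult_iff)
  have "sigma_min M * norm x \<le> norm (M *v x)" for x
  proof -
    have "sqrt l * norm x = sqrt (l * (norm x)\<^sup>2)" by (simp add: real_sqrt_mult)
    also have "\<dots> \<le> sqrt ((norm (M *v x))\<^sup>2)"
      using l(3)[of x] unfolding gram_quadratic by (rule real_sqrt_le_mono)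
    also have "\<dots> = norm (M *v x)" by simp
    finally show ?thesis using mult_right_mono[OF le, of "norm x"] by simp
  qed
  then show thesis using that[of v] k kv s0 by simp
qed

lemma sigma_min_norm_le:
  fixes M :: "real^'c^'r"
  assumes "CARD('c) \<le> CARD('r)"
  shows "sigma_min M * norm x \<le> norm (M *v x)"
  using sigma_min_attained[OF assms] by metis

lemma sigma_min_pos:
  fixes M :: "real^'c^'r"
  assumes "CARD('c) \<le> CARD('r)" "\<And>x. M *v x = 0 \<Longrightarrow> x = 0"
  shows "0 < sigma_min M"
proof -
  obtain v where v: "v \<noteq> 0" "sigma_min M * norm v = norm (M *v v)" "0 \<le> sigma_min M"
    using sigma_min_attained[OF assms(1)] by metis
  then have "sigma_min M \<noteq> 0" using assms(2)[of v] by auto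
  then show ?thesis using v(3) by simp
qed

lemma
  fixes Q :: "real^'n^'n"
  assumes "pos_def Q"
  shows pos_def_psd: "psd Q"
    and pos_def_sym: "transpose Q = Q"
    and pos_def_sigma_min_pos: "0 < sigma_min Q"
    and pos_def_sigma_min_le: "sigma_min Q * (norm x)\<^sup>2 \<le> x \<bullet> (Q *v x)"
proof -
  have pos: "x \<noteq> 0 \<Longrightarrow> x \<bullet> (Q *v x) > 0" for x using assms by (simp add: pos_def_def)
  show sym: "transpose Q = Q" using assms by (simp add: pos_def_def)
  have "0 \<le> x \<bullet> (Q *v x)" for x using pos[of x] by (cases "x = 0") auto
  then show "psd Q" by (simp add: psd_def)
  have "x = 0" if "Q *v x = 0" for x using pos[of x] that by (cases "x = 0") auto
  then show "0 < sigma_min Q" by (intro sigma_min_pos) auto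
  obtain l v where l: "norm v = 1" "Q *v v = l *\<^sub>R v" "\<And>x. l * (norm x)\<^sup>2 \<le> x \<bullet> (Q *v x)"
    using rayleigh_minimum[OF sym] by blast
  have v0: "v \<noteq> 0" using l(1) by auto
  have "v \<bullet> v = 1" using l(1) by (simp add: norm_eq_1)
  with pos[OF v0] have "l > 0" by (simp add: l(2))
  \<comment> \<open>\<open>sigma_min\<close> takes roots of eigenvalues of Q^T Q = Q^2, where the
    smallest eigenvalue \<open>l\<close> of \<open>Q\<close> appears squared.\<close>
  have "(transpose Q ** Q) *v v = l\<^sup>2 *\<^sub>R v"
    unfolding sym by (simp add: matrix_vector_mul_assoc[symmetric] l(2) matrix_vector_mult_scaleR power2_eq_square)
  from sigma_min_le[OF order_refl v0 this] have "sigma_min Q \<le> l" using \<open>l > 0\<close> by simp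
  then have "sigma_min Q * (norm x)\<^sup>2 \<le> l * (norm x)\<^sup>2" by (intro mult_right_mono) auto
  then show "sigma_min Q * (norm x)\<^sup>2 \<le> x \<bullet> (Q *v x)" using l(3)[of x] by simp
qed

lemma norm_mult_le_opnorm: "norm (M *v x) \<le> opnorm M * norm x" for M :: "real^'n^'m"
  unfolding opnorm_def by (rule onorm[OF matrix_vector_mul_bounded_linear])

lemma opnorm_nonneg: "0 \<le> opnorm (M :: real^'n^'m)"
  unfolding opnorm_def by (rule onorm_pos_le[OF matrix_vector_mul_bounded_linear])

lemma opnorm_pos: "M \<noteq> 0 \<Longrightarrow> 0 < opnorm (M :: real^'n^'m)"
  unfolding opnorm_def onorm_pos_lt[OF matrix_vector_mul_bounded_linear] by (simp add: matrix_eq)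

lemma quadratic_le_opnorm: "x \<bullet> (M *v x) \<le> opnorm M * (norm x)\<^sup>2" for M :: "real^'n^'n"
proof -
  have "x \<bullet> (M *v x) \<le> norm x * norm (M *v x)" by (rule norm_cauchy_schwarz)
  also have "\<dots> \<le> norm x * (opnorm M * norm x)" by (intro mult_left_mono norm_mult_le_opnorm) auto
  finally show ?thesis by (simp add: power2_eq_square mult_ac)
qed

text \<open>Polarization followed by the parallelogram law settles unit vectors, and scaling the
  rest. Symmetry is what keeps the constant unchanged in passing from the quadratic to the bilinear
  form.\<close>

lemma sym_bilinear_le:
  fixes S :: "real^'n^'n"
  assumes "transpose S = S" "\<And>x. \<bar>x \<bullet> (S *v x)\<bar> \<le> c * (norm x)\<^sup>2"
  shows "a \<bullet> (S *v b) \<le> c * (norm a * norm b)"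
proof -
  have unit: "a \<bullet> (S *v b) \<le> c" if "norm a = 1" "norm b = 1" for a b
  proof -
    have "4 * (a \<bullet> (S *v b)) = (a + b) \<bullet> (S *v (a + b)) - (a - b) \<bullet> (S *v (a - b))"
      using sym_inner_commute[OF assms(1), of b a]
      by (simp add: matrix_vector_right_distrib matrix_vector_mult_diff_distrib inner_add_left
          inner_add_right inner_diff_left inner_diff_right inner_commute)
    also have "\<dots> \<le> c * (norm (a + b))\<^sup>2 + c * (norm (a - b))\<^sup>2"
      using assms(2)[of "a + b"] assms(2)[of "a - b"] by linarith
    also have "\<dots> = 4 * c"
      using that unfolding power2_norm_eq_inner norm_eq_1
      by (simp add: inner_add_left inner_add_right inner_diff_left inner_diff_right algebra_simps)
    finally show ?thesis by simp
  qed
  show ?thesis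
  proof (cases "a = 0 \<or> b = 0")
    case False
    then have "((1 / norm a) *\<^sub>R a) \<bullet> (S *v ((1 / norm b) *\<^sub>R b)) \<le> c" by (intro unit) auto
    then have "a \<bullet> (S *v b) / (norm a * norm b) \<le> c"
      by (simp add: matrix_vector_mult_scaleR mult.commute)
    then show ?thesis using False by (simp add: pos_divide_le_eq)
  qed auto
qed

section \<open>The cost and its derivatives\<close>

lemma matrix_mult_minus_left: "(- X) ** Y = - (X ** (Y :: real^'k^'n))"
  by (rule bounded_bilinear.minus_left[OF bounded_bilinear_matrix_mult])

lemma matrix_mult_minus_right: "X ** (- Y) = - (X ** (Y :: real^'k^'n))"
  by (rule bounded_bilinear.minus_right[OF bounded_bilinear_matrix_mult])

lemmas matrix_ring_simps = matrix_add_ldistrib matrix_add_rdistrib matrix_diff_ldistrib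
  matrix_diff_rdistrib matrix_mult_minus_left matrix_mult_minus_right matrix_transpose_mul
  transpose_add transpose_diff transpose_minus matrix_mul_assoc

lemmas has_derivative_matrix_mult = bounded_bilinear.FDERIV[OF bounded_bilinear_matrix_mult]
lemmas has_derivative_transpose = bounded_linear.has_derivative[OF bounded_linear_transpose]

text \<open>Expand the form at a - z b and divide by z; replacing a by -a gives the absolute
  value.\<close>

lemma psd_young:
  fixes Y :: "real^'n^'n"
  assumes "psd Y" "transpose Y = Y" "0 < z"
  shows "2 * \<bar>a \<bullet> (Y *v b)\<bar> \<le> (a \<bullet> (Y *v a)) / z + z * (b \<bullet> (Y *v b))"
proof -
  have *: "2 * (a \<bullet> (Y *v b)) \<le> (a \<bullet> (Y *v a)) / z + z * (b \<bullet> (Y *v b))" for a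
  proof -
    have "0 \<le> (a - z *\<^sub>R b) \<bullet> (Y *v (a - z *\<^sub>R b))" by (rule psdD[OF assms(1)])
    also have "\<dots> = a \<bullet> (Y *v a) - 2 * z * (a \<bullet> (Y *v b)) + z\<^sup>2 * (b \<bullet> (Y *v b))"
      using sym_inner_commute[OF assms(2), of b a]
      by (simp add: matrix_vector_mult_diff_distrib matrix_vector_mult_scaleR inner_diff_left
          inner_diff_right inner_commute power2_eq_square algebra_simps)
    finally have "2 * (a \<bullet> (Y *v b)) * z \<le> a \<bullet> (Y *v a) + z\<^sup>2 * (b \<bullet> (Y *v b))"
      by (simp add: mult_ac)
    then have "2 * (a \<bullet> (Y *v b)) \<le> (a \<bullet> (Y *v a) + z\<^sup>2 * (b \<bullet> (Y *v b))) / z"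
      using assms(3) by (simp only: pos_le_divide_eq)
    also have "\<dots> = (a \<bullet> (Y *v a)) / z + z * (b \<bullet> (Y *v b))"
      using assms(3) by (simp add: add_divide_distrib power2_eq_square)
    finally show ?thesis .
  qed
  have "(- a) \<bullet> (Y *v b) = - (a \<bullet> (Y *v b))" by simp
  moreover have "(- a) \<bullet> (Y *v (- a)) = a \<bullet> (Y *v a)"
    by (simp add: linear_neg[OF matrix_vector_mul_linear])
  ultimately show ?thesis using *[of a] *[of "- a"] by (simp add: abs_if)
qed

lemma quadratic_conj: "x \<bullet> ((transpose F ** Y ** G) *v y) = (F *v x) \<bullet> (Y *v (G *v (y :: real^'k)))"
  by (simp add: inner_matrix_vector_left matrix_vector_mul_assoc matrix_mul_assoc)

text \<open>Each partial sum is continuous in the matrix, so a common bound passes to the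
  limit.\<close>

lemma schur_stable_limit:
  fixes F :: "'b \<Rightarrow> real^'n^'n"
  assumes "(F \<longlongrightarrow> M) G" "G \<noteq> bot"
    and "\<forall>\<^sub>F s in G. \<forall>x N. (\<Sum>t<N. (norm (state (F s) x t))\<^sup>2) \<le> c x"
  shows "schur_stable M"
proof (rule schur_stable_bounded)
  fix x N
  have lim: "((\<lambda>s. state (F s) x t) \<longlongrightarrow> state M x t) G" for t
  proof (induction t)
    case (Suc t)
    have "bounded_bilinear ((*v) :: real^'n^'n \<Rightarrow> real^'n \<Rightarrow> real^'n)"
    proof
      show "\<exists>K. \<forall>a b. norm (a *v b) \<le> norm (a :: real^'n^'n) * norm (b :: real^'n) * K"
        by (intro exI[of _ 1]) (simp add: norm_matrix_vector_mult_le)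
    qed (simp_all add: matrix_vector_mult_add_rdistrib matrix_vector_right_distrib
        scaleR_matrix_vector matrix_vector_mult_scaleR)
    from bounded_bilinear.tendsto[OF this assms(1) Suc] show ?case by (simp add: state_Suc)
  qed simp
  have "((\<lambda>s. \<Sum>t<N. (norm (state (F s) x t))\<^sup>2) \<longlongrightarrow> (\<Sum>t<N. (norm (state M x t))\<^sup>2)) G"
    by (intro tendsto_intros lim)
  then show "(\<Sum>t<N. (norm (state M x t))\<^sup>2) \<le> c x"
    using assms(3) by (intro tendsto_upperbound[OF _ _ assms(2)]) (auto elim: eventually_mono)
qed

locale sof =
  fixes A :: "real^'n^'n" and B :: "real^'m^'n" and C :: "real^'n^'d"
    and Q :: "real^'n^'n" and R :: "real^'m^'m" and X0 :: "real^'n^'n" and \<alpha> :: real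
  assumes B0: "B \<noteq> 0" and C0: "C \<noteq> 0" and Q: "pos_def Q" and R: "pos_def R" and X0: "pos_def X0"
begin

definition M :: "real^'d^'m \<Rightarrow> real^'n^'n" where
  "M K = closed_loop A B C K"

definition W :: "real^'d^'m \<Rightarrow> real^'n^'n" where
  "W K = Q + transpose C ** transpose K ** R ** K ** C"

definition P :: "real^'d^'m \<Rightarrow> real^'n^'n" where
  "P K = lyap (transpose (M K)) (W K)"

definition S :: "real^'d^'m \<Rightarrow> real^'n^'n" where
  "S K = lyap (M K) X0"

definition J :: "real^'d^'m \<Rightarrow> real" where
  "J K = X0 \<bullet> P K"

text \<open>The first-order residual (R + B^T P B) K C - B^T P A; it vanishes when K C is the best
  one-step feedback against the cost-to-go \<open>P K\<close>.\<close>

definition E :: "real^'d^'m \<Rightarrow> real^'n^'m" where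
  "E K = R ** K ** C - transpose B ** P K ** M K"

text \<open>The right-hand side of the Lyapunov equation for the derivative of \<open>P\<close> in
  direction \<open>Z\<close>.\<close>

definition N :: "real^'d^'m \<Rightarrow> real^'d^'m \<Rightarrow> real^'n^'n" where
  "N K Z = transpose (Z ** C) ** E K + transpose (E K) ** (Z ** C)"

definition P' :: "real^'d^'m \<Rightarrow> real^'d^'m \<Rightarrow> real^'n^'n" where
  "P' K Z = lyap (transpose (M K)) (N K Z)"

definition E' :: "real^'d^'m \<Rightarrow> real^'d^'m \<Rightarrow> real^'n^'m" where
  "E' K Z = R ** Z ** C - transpose B ** P' K Z ** M K + transpose B ** P K ** (B ** Z ** C)"

text \<open>The second derivative of \<open>J\<close> along s -> K + s Z. The last term collects two
  equal contributions, from the derivative of \<open>P\<close> inside \<open>E\<close> and from the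
  derivative of \<open>S\<close>.\<close>

definition curvature :: "real^'d^'m \<Rightarrow> real^'d^'m \<Rightarrow> real" where
  "curvature K Z = 2 * (S K \<bullet> (transpose (Z ** C) ** R ** (Z ** C) + transpose (B ** Z ** C) ** P K ** (B ** Z ** C)))
    - 4 * (P' K Z \<bullet> (B ** Z ** C ** S K ** transpose (M K)))"

definition grad :: "real^'d^'m \<Rightarrow> real^'d^'m" where
  "grad K = 2 *\<^sub>R (E K ** S K ** transpose C)"

abbreviation "stab K \<equiv> schur_stable (M K)"
abbreviation "\<mu> \<equiv> sigma_min X0"
abbreviation "\<sigma> \<equiv> sigma_min Q"
abbreviation "\<zeta> \<equiv> zeta1 B C Q R \<mu> \<alpha>"
abbreviation "L \<equiv> smooth_const B C Q R \<mu> \<alpha>"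

lemmas symQ = pos_def_sym[OF Q]
lemmas symR = pos_def_sym[OF R]
lemmas symX0 = pos_def_sym[OF X0]
lemmas mu_pos = pos_def_sigma_min_pos[OF X0]
lemmas sigma_pos = pos_def_sigma_min_pos[OF Q]

lemma quadratic_W: "x \<bullet> (W K *v x) = x \<bullet> (Q *v x) + (K *v (C *v x)) \<bullet> (R *v (K *v (C *v x)))"
  using quadratic_conj[of x "K ** C" R "K ** C" x]
  by (simp add: W_def matrix_vector_mult_add_rdistrib inner_add_right matrix_transpose_mul
      matrix_mul_assoc matrix_vector_mul_assoc)

lemma psd_W: "psd (W K)"
  unfolding psd_def quadratic_W using psdD[OF pos_def_psd[OF Q]] psdD[OF pos_def_psd[OF R]]
  by (auto intro: add_nonneg_nonneg)

lemma sym_W: "transpose (W K) = W K"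
  by (simp add: W_def matrix_ring_simps symQ symR)

lemma sym_N: "transpose (N K Z) = N K Z"
  by (simp add: N_def matrix_ring_simps add.commute)

context
  fixes K :: "real^'d^'m"
  assumes st: "stab K"
begin

lemmas st' = schur_stable_transpose[OF st]

lemma sym_P: "transpose (P K) = P K"
  by (simp add: P_def transpose_lyap[OF st'] sym_W)

lemma psd_P: "psd (P K)"
  unfolding P_def by (rule psd_lyap[OF st' psd_W])

lemma sym_S: "transpose (S K) = S K"
  by (simp add: S_def transpose_lyap[OF st] symX0)

lemma psd_S: "psd (S K)"
  unfolding S_def by (rule psd_lyap[OF st pos_def_psd[OF X0]])

lemma sym_P': "transpose (P' K Z) = P' K Z"
  by (simp add: P'_def transpose_lyap[OF st'] sym_N)

text \<open>The Bellman equation of the closed loop.\<close>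

lemma quadratic_P: "x \<bullet> (P K *v x) = x \<bullet> (W K *v x) + (M K *v x) \<bullet> (P K *v (M K *v x))"
proof -
  have "P K = W K + congr (transpose (M K)) (P K)"
    unfolding P_def by (rule lyap_eq[OF st'])
  then have "x \<bullet> (P K *v x) = x \<bullet> ((W K + congr (transpose (M K)) (P K)) *v x)" by simp
  then show ?thesis
    by (simp add: matrix_vector_mult_add_rdistrib inner_add_right quadratic_congr)
qed

lemma S_inner: "S K \<bullet> Y = X0 \<bullet> lyap (transpose (M K)) Y"
  unfolding S_def by (rule inner_lyap[OF st])

lemma J_eq: "J K = S K \<bullet> W K"
  by (simp add: J_def P_def S_inner)

text \<open>X0 is at least \<mu> times the identity. Here and in \<open>trace_S\<close> the
  quotients \<alpha>/\<mu> and \<alpha>/\<sigma> of the smoothness constant originate.\<close>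

lemma trace_P: "\<mu> * (P K \<bullet> mat 1) \<le> J K"
  using trace_inner_ge[OF psd_P sym_P pos_def_sigma_min_le[OF X0]]
  by (simp add: J_def inner_commute)

lemma trace_S: "\<sigma> * (S K \<bullet> mat 1) \<le> J K"
  unfolding J_eq
proof (rule trace_inner_ge[OF psd_S sym_S])
  show "\<sigma> * (norm x)\<^sup>2 \<le> x \<bullet> (W K *v x)" for x
    using pos_def_sigma_min_le[OF Q, of x] psdD[OF pos_def_psd[OF R]] unfolding quadratic_W
    by (simp add: add_increasing2)
qed

lemma J_nonneg: "0 \<le> J K"
  unfolding J_eq by (rule inner_psd_nonneg[OF psd_S sym_S psd_W])

lemma S_ge_X0: "\<mu> * (norm x)\<^sup>2 \<le> x \<bullet> (S K *v x)"
  using psdD[OF psd_lyap_diff[OF st pos_def_psd[OF X0]], of x] pos_def_sigma_min_le[OF X0, of x]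
  unfolding S_def[symmetric]
  by (simp add: matrix_vector_mult_diff_rdistrib inner_diff_right)

lemma has_derivative_M: "(M has_derivative (\<lambda>Z. - (B ** Z ** C))) (at K)"
  unfolding M_def closed_loop_def
  by (rule has_derivative_eq_rhs,
      rule has_derivative_diff[OF has_derivative_const
        has_derivative_matrix_mult[OF has_derivative_matrix_mult[OF has_derivative_const has_derivative_ident] has_derivative_const]])
    (simp add: fun_eq_iff)

lemma has_derivative_W:
  "(W has_derivative (\<lambda>Z. transpose (Z ** C) ** R ** (K ** C) + transpose (K ** C) ** R ** (Z ** C))) (at K)"
proof -
  have W: "W = (\<lambda>K. Q + transpose (K ** C) ** R ** (K ** C))"
    by (simp add: fun_eq_iff W_def matrix_ring_simps)
  have KC: "((\<lambda>K. K ** C) has_derivative (\<lambda>Z. Z ** C)) (at K)"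
    using has_derivative_matrix_mult[OF has_derivative_ident has_derivative_const[of C]]
    by (simp add: fun_eq_iff)
  have "((\<lambda>K. transpose (K ** C) ** R) has_derivative (\<lambda>Z. transpose (Z ** C) ** R)) (at K)"
    using has_derivative_matrix_mult[OF has_derivative_transpose[OF KC] has_derivative_const[of R]]
    by (simp add: fun_eq_iff)
  from has_derivative_add[OF has_derivative_const[of Q] has_derivative_matrix_mult[OF this KC]]
  show ?thesis unfolding W by (simp add: add.commute)
qed

lemma has_derivative_P: "(P has_derivative P' K) (at K)"
proof -
  have "(P has_derivative (\<lambda>Z. lyap (transpose (M K))
      (transpose (Z ** C) ** R ** (K ** C) + transpose (K ** C) ** R ** (Z ** C)
        + (transpose (- (B ** Z ** C)) ** P K ** transpose (transpose (M K))
          + transpose (M K) ** P K ** transpose (transpose (- (B ** Z ** C))))))) (at K)"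
    unfolding P_def
    by (rule has_derivative_lyap[OF has_derivative_transpose[OF has_derivative_M] has_derivative_W st'])
  \<comment> \<open>By symmetry of \<open>R\<close> and \<open>P K\<close> the terms with a
    transposed \<open>Z\<close> combine to (Z C)^T E, and the others to its transpose.\<close>
  also have "(\<lambda>Z. lyap (transpose (M K))
      (transpose (Z ** C) ** R ** (K ** C) + transpose (K ** C) ** R ** (Z ** C)
        + (transpose (- (B ** Z ** C)) ** P K ** transpose (transpose (M K))
          + transpose (M K) ** P K ** transpose (transpose (- (B ** Z ** C)))))) = P' K"
    unfolding P'_def N_def E_def
    by (intro ext arg_cong[of _ _ "lyap _"]) (simp add: matrix_ring_simps symR sym_P)
  finally show ?thesis .
qed

lemma has_derivative_S:
  "(S has_derivative (\<lambda>Z. lyap (M K)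
    (- (B ** Z ** C) ** S K ** transpose (M K) + M K ** S K ** transpose (- (B ** Z ** C))))) (at K)"
  using has_derivative_lyap[OF has_derivative_M has_derivative_const st, of X0]
  by (simp add: S_def[abs_def])

lemma S_inner_transpose_mult:
  "S K \<bullet> (transpose F ** G) = F \<bullet> (G ** S K)" for F G :: "real^'n^'m"
  by (metis inner_matrix_mult_left inner_matrix_mult_right sym_S transpose_transpose)

lemma S_inner_symmetrized:
  "S K \<bullet> (transpose V ** F + transpose F ** V) = 2 * (V \<bullet> (F ** S K))" for V F :: "real^'n^'m"
proof -
  have "S K \<bullet> (transpose F ** V) = transpose (S K) \<bullet> transpose (transpose F ** V)"
    by (rule inner_transpose[symmetric])
  also have "\<dots> = S K \<bullet> (transpose V ** F)"
    by (simp only: sym_S matrix_transpose_mul transpose_transpose)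
  finally show ?thesis by (simp add: inner_add_right S_inner_transpose_mult)
qed

text \<open>Two forms of the directional derivative of \<open>J\<close>: the left one is
  differentiated once more, the right one isolates the direction.\<close>

lemma slope_eq: "S K \<bullet> N K Z = Z \<bullet> grad K"
  unfolding N_def S_inner_symmetrized grad_def by (simp add: inner_matrix_mult_right)

lemma has_derivative_J: "(J has_derivative (\<lambda>Z. Z \<bullet> grad K)) (at K)"
  unfolding slope_eq[symmetric] S_inner P'_def[symmetric] J_def[abs_def]
  by (rule bounded_linear.has_derivative[OF bounded_linear_inner_right has_derivative_P])

lemma has_derivative_E: "(E has_derivative E' K) (at K)"
proof -
  have 1: "((\<lambda>K. R ** K ** C) has_derivative (\<lambda>Z. R ** Z ** C)) (at K)"
    using has_derivative_matrix_mult[OF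
        has_derivative_matrix_mult[OF has_derivative_const[of R] has_derivative_ident] has_derivative_const[of C]]
    by (simp add: fun_eq_iff)
  have "((\<lambda>K. transpose B ** P K) has_derivative (\<lambda>Z. transpose B ** P' K Z)) (at K)"
    using has_derivative_matrix_mult[OF has_derivative_const has_derivative_P, of "transpose B"]
    by (simp add: fun_eq_iff)
  note D = has_derivative_diff[OF 1 has_derivative_matrix_mult[OF this has_derivative_M]]
  have "(\<lambda>Z. R ** Z ** C - (transpose B ** P K ** - (B ** Z ** C) + transpose B ** P' K Z ** M K)) = E' K"
    by (simp add: E'_def fun_eq_iff matrix_ring_simps)
  with D show ?thesis by (simp add: E_def[abs_def])
qed

text \<open>Only the value in the direction \<open>Z\<close> itself is identified, since second
  derivatives are taken along lines.\<close>

lemma has_derivative_slope: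
  "\<exists>f'. ((\<lambda>K. S K \<bullet> N K Z) has_derivative f') (at K) \<and> f' Z = curvature K Z"
proof -
  let ?V = "Z ** C"
  let ?D = "\<lambda>Z. - (B ** Z ** C) ** S K ** transpose (M K) + M K ** S K ** transpose (- (B ** Z ** C))"
  have N': "((\<lambda>K. N K Z) has_derivative (\<lambda>h. transpose ?V ** E' K h + transpose (E' K h) ** ?V)) (at K)"
  proof -
    have "((\<lambda>K. transpose ?V ** E K) has_derivative (\<lambda>h. transpose ?V ** E' K h)) (at K)"
      using has_derivative_matrix_mult[OF has_derivative_const has_derivative_E, of "transpose ?V"]
      by (simp add: fun_eq_iff)
    moreover have "((\<lambda>K. transpose (E K) ** ?V) has_derivative (\<lambda>h. transpose (E' K h) ** ?V)) (at K)"
      using has_derivative_matrix_mult[OF has_derivative_transpose[OF has_derivative_E] has_derivative_const[of ?V]]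
      by (simp add: fun_eq_iff)
    ultimately show ?thesis unfolding N_def by (rule has_derivative_add)
  qed
  have D: "((\<lambda>K. S K \<bullet> N K Z) has_derivative
    (\<lambda>h. S K \<bullet> (transpose ?V ** E' K h + transpose (E' K h) ** ?V) + lyap (M K) (?D h) \<bullet> N K Z)) (at K)"
    by (rule has_derivative_inner[OF has_derivative_S N'])
  let ?BV = "B ** Z ** C"
  have c1: "?V \<bullet> (R ** Z ** C ** S K) = S K \<bullet> (transpose ?V ** R ** ?V)"
    using S_inner_transpose_mult[of ?V "R ** ?V"] by (simp add: matrix_mul_assoc)
  have c2: "?V \<bullet> (transpose B ** P K ** ?BV ** S K) = S K \<bullet> (transpose ?BV ** P K ** ?BV)"
    using S_inner_transpose_mult[of ?V "transpose B ** P K ** ?BV"] by (simp add: matrix_mul_assoc matrix_transpose_mul)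
  have c3: "?V \<bullet> (transpose B ** P' K Z ** M K ** S K) = P' K Z \<bullet> (?BV ** S K ** transpose (M K))"
  proof -
    have "?V \<bullet> (transpose B ** (P' K Z ** M K ** S K)) = ?BV \<bullet> (P' K Z ** M K ** S K)"
      using inner_matrix_mult_left[of B ?V "P' K Z ** M K ** S K"] by (simp add: matrix_mul_assoc)
    also have "\<dots> = (P' K Z ** (M K ** S K)) \<bullet> ?BV" by (simp only: inner_commute matrix_mul_assoc)
    also have "\<dots> = P' K Z \<bullet> (?BV ** transpose (M K ** S K))" by (rule inner_matrix_mult_right)
    finally show ?thesis by (simp add: matrix_mul_assoc matrix_transpose_mul sym_S)
  qed
  \<comment> \<open>Adjointness moves \<open>lyap\<close> from the derivative of \<open>S\<close>
    onto \<open>N\<close>, where it produces \<open>P'\<close>; this yields the same inner product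
    as \<open>c3\<close>.\<close>
  have c4: "lyap (M K) (?D Z) \<bullet> N K Z = - 2 * (P' K Z \<bullet> (?BV ** S K ** transpose (M K)))"
  proof -
    have "lyap (M K) (?D Z) \<bullet> N K Z = ?D Z \<bullet> P' K Z"
      unfolding P'_def by (rule inner_lyap[OF st])
    also have "\<dots> = - ((?BV ** S K ** transpose (M K)) \<bullet> P' K Z
        + transpose (?BV ** S K ** transpose (M K)) \<bullet> transpose (P' K Z))"
    proof -
      have "?D Z = - (?BV ** S K ** transpose (M K)) - transpose (?BV ** S K ** transpose (M K))"
        by (simp add: matrix_ring_simps sym_S)
      then show ?thesis by (simp only: inner_diff_left inner_minus_left sym_P')
    qed
    also have "\<dots> = - 2 * (P' K Z \<bullet> (?BV ** S K ** transpose (M K)))"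
      by (simp only: inner_transpose) (simp add: inner_commute)
    finally show ?thesis .
  qed
  have "S K \<bullet> (transpose ?V ** E' K Z + transpose (E' K Z) ** ?V) + lyap (M K) (?D Z) \<bullet> N K Z = curvature K Z"
    unfolding S_inner_symmetrized c4
    unfolding curvature_def E'_def matrix_diff_rdistrib matrix_add_rdistrib inner_diff_right
      inner_add_right c1 c2 c3 by simp
  with D show ?thesis by blast
qed

end

end

section \<open>The curvature bound\<close>

lemma has_derivative_line:
  fixes F :: "'a::real_normed_vector \<Rightarrow> real"
  assumes "(F has_derivative F') (at (K + s *\<^sub>R Z))"
  shows "((\<lambda>s. F (K + s *\<^sub>R Z)) has_real_derivative F' Z) (at s)"
proof -
  have "((\<lambda>s. K + s *\<^sub>R Z) has_derivative (\<lambda>h. h *\<^sub>R Z)) (at s)"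
    by (auto intro!: derivative_eq_intros)
  from has_derivative_compose[OF this assms]
  have "((\<lambda>s. F (K + s *\<^sub>R Z)) has_derivative (\<lambda>h. F' (h *\<^sub>R Z))) (at s)" .
  moreover have "F' (h *\<^sub>R Z) = F' Z * h" for h
    using linear_cmul[OF bounded_linear.linear[OF has_derivative_bounded_linear[OF assms]], of h Z] by simp
  ultimately show ?thesis by (simp add: has_field_derivative_def)
qed

context sof
begin

lemma isCont_M: "isCont M K"
  unfolding M_def closed_loop_def
  by (intro continuous_diff continuous_const continuous_matrix_mult continuous_ident)

context
  fixes K :: "real^'d^'m"
  assumes st: "stab K" and le: "J K \<le> \<alpha>"
begin

lemma alpha_nonneg: "0 \<le> \<alpha>"
  using J_nonneg[OF st] le by simp

lemma quadratic_P_le: "x \<bullet> (P K *v x) \<le> \<alpha> / \<mu> * (norm x)\<^sup>2"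
proof -
  have "\<mu> * (P K \<bullet> mat 1) \<le> \<alpha>" using trace_P[OF st] le by simp
  then have "P K \<bullet> mat 1 \<le> \<alpha> / \<mu>" using mu_pos by (simp add: pos_le_divide_eq mult.commute)
  then have "(P K \<bullet> mat 1) * (norm x)\<^sup>2 \<le> \<alpha> / \<mu> * (norm x)\<^sup>2" by (rule mult_right_mono) simp
  with quadratic_le_trace[OF psd_P[OF st] sym_P[OF st], of x] show ?thesis by linarith
qed

lemma trace_S_le: "S K \<bullet> mat 1 \<le> \<alpha> / \<sigma>"
  using trace_S[OF st] le sigma_pos by (simp add: pos_le_divide_eq mult.commute)

text \<open>\<open>P K\<close> is a Lyapunov function whose dissipation \<sigma> is supplied by
  \<open>Q\<close>. The right side does not mention \<open>K\<close>, so it is uniform over the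
  sublevel set.\<close>

lemma state_bound: "(\<Sum>t<n. (norm (state (M K) x t))\<^sup>2) \<le> \<alpha> / \<mu> * (norm x)\<^sup>2 / \<sigma>"
proof -
  have "\<sigma> * (norm x)\<^sup>2 + (M K *v x) \<bullet> (P K *v (M K *v x)) \<le> x \<bullet> (P K *v x)" for x
    using quadratic_P[OF st, of x] quadratic_W[of x K] pos_def_sigma_min_le[OF Q, of x]
      psdD[OF pos_def_psd[OF R], of "K *v (C *v x)"] by linarith
  from state_sum_bound[OF psd_P[OF st] this, where N = n and x = x] quadratic_P_le[of x]
  have "\<sigma> * (\<Sum>t<n. (norm (state (M K) x t))\<^sup>2) \<le> \<alpha> / \<mu> * (norm x)\<^sup>2" by linarith
  then show ?thesis using sigma_pos by (simp only: pos_le_divide_eq mult.commute[of \<sigma>])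
qed

context
  fixes Z :: "real^'d^'m"
begin

lemma norm_ZC: "norm ((Z ** C) *v x) \<le> norm Z * opnorm C * norm x"
proof -
  have "norm (Z *v (C *v x)) \<le> norm Z * norm (C *v x)" by (rule norm_matrix_vector_mult_le)
  also have "\<dots> \<le> norm Z * (opnorm C * norm x)" by (intro mult_left_mono norm_mult_le_opnorm) simp
  finally show ?thesis by (simp add: matrix_vector_mul_assoc mult.assoc)
qed

lemma quadratic_Z:
  defines "v \<equiv> \<lambda>x. (Z ** C) *v x"
  shows "v x \<bullet> (R *v v x) + (B *v v x) \<bullet> (P K *v (B *v v x))
    \<le> (opnorm R + \<alpha> / \<mu> * (opnorm B)\<^sup>2) * (opnorm C)\<^sup>2 * (norm Z)\<^sup>2 * (norm x)\<^sup>2"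
proof -
  have v: "(norm (v x))\<^sup>2 \<le> (norm Z * opnorm C * norm x)\<^sup>2"
    unfolding v_def by (intro power_mono norm_ZC) simp
  have am: "0 \<le> \<alpha> / \<mu>" using alpha_nonneg mu_pos by simp
  have "v x \<bullet> (R *v v x) \<le> opnorm R * (norm (v x))\<^sup>2" by (rule quadratic_le_opnorm)
  moreover have "(B *v v x) \<bullet> (P K *v (B *v v x)) \<le> \<alpha> / \<mu> * (norm (B *v v x))\<^sup>2"
    by (rule quadratic_P_le)
  moreover have "\<alpha> / \<mu> * (norm (B *v v x))\<^sup>2 \<le> \<alpha> / \<mu> * (opnorm B * norm (v x))\<^sup>2"
    by (intro mult_left_mono power_mono norm_mult_le_opnorm am) simp
  ultimately have "v x \<bullet> (R *v v x) + (B *v v x) \<bullet> (P K *v (B *v v x))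
      \<le> (opnorm R + \<alpha> / \<mu> * (opnorm B)\<^sup>2) * (norm (v x))\<^sup>2"
    by (simp add: power_mult_distrib distrib_right mult.assoc)
  also have "\<dots> \<le> (opnorm R + \<alpha> / \<mu> * (opnorm B)\<^sup>2) * (norm Z * opnorm C * norm x)\<^sup>2"
    by (intro mult_left_mono v add_nonneg_nonneg mult_nonneg_nonneg opnorm_nonneg am zero_le_power2)
  finally show ?thesis by (simp add: power_mult_distrib mult_ac)
qed

lemma quadratic_N:
  "x \<bullet> (N K Z *v x) = 2 * (((Z ** C) *v x) \<bullet> (R *v (K *v (C *v x))))
    - 2 * ((B *v ((Z ** C) *v x)) \<bullet> (P K *v (M K *v x)))"
proof -
  let ?v = "(Z ** C) *v x"
  have "x \<bullet> ((transpose (Z ** C) ** E K) *v x) = ?v \<bullet> (E K *v x)"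
    by (simp add: inner_matrix_vector_left matrix_vector_mul_assoc)
  moreover have "x \<bullet> ((transpose (E K) ** (Z ** C)) *v x) = ?v \<bullet> (E K *v x)"
    by (simp add: inner_matrix_vector_left[of "E K"] matrix_vector_mul_assoc inner_commute[of ?v])
  ultimately have "x \<bullet> (N K Z *v x) = 2 * (?v \<bullet> (E K *v x))"
    by (simp add: N_def matrix_vector_mult_add_rdistrib inner_add_right)
  moreover have "?v \<bullet> (E K *v x) = ?v \<bullet> (R *v (K *v (C *v x))) - (B *v ?v) \<bullet> (P K *v (M K *v x))"
  proof -
    have "E K *v x = R *v (K *v (C *v x)) - transpose B *v (P K *v (M K *v x))"
      by (simp add: E_def matrix_vector_mult_diff_rdistrib matrix_vector_mul_assoc matrix_mul_assoc)
    then show ?thesis by (simp add: inner_diff_right inner_matrix_vector_left[of B])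
  qed
  ultimately show ?thesis by simp
qed

text \<open>
  The constant \<open>\<zeta>\<close> arises here: Young's inequality bounds \<open>N\<close> by multiples of the two quadratic
  forms that occur in the Lyapunov equation of \<open>P\<close>, and these add up to \<open>P - Q\<close>.
\<close>

lemma N_bound:
  assumes "Z \<noteq> 0"
  shows "\<bar>x \<bullet> (N K Z *v x)\<bar> \<le> norm Z * \<zeta> * (x \<bullet> (Q *v x))"
proof -
  have z: "norm Z > 0" using assms by simp
  define v k m where "v = (Z ** C) *v x" and "k = K *v (C *v x)" and "m = M K *v x"
  \<comment> \<open>c / \<sigma> equals \<zeta> + 1; the 1 is removed by the term - x . Q x.\<close>
  define c where "c = \<alpha> / \<mu> * (1 + (opnorm B)\<^sup>2 * (opnorm C)\<^sup>2) + opnorm R * (opnorm C)\<^sup>2"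
  have "c \<ge> 0" using alpha_nonneg mu_pos opnorm_nonneg[of R] by (simp add: c_def)
  have "x \<bullet> (N K Z *v x) = 2 * (v \<bullet> (R *v k)) - 2 * ((B *v v) \<bullet> (P K *v m))"
    by (simp add: quadratic_N v_def k_def m_def)
  then have "\<bar>x \<bullet> (N K Z *v x)\<bar> \<le> 2 * \<bar>v \<bullet> (R *v k)\<bar> + 2 * \<bar>(B *v v) \<bullet> (P K *v m)\<bar>" by linarith
  \<comment> \<open>The weight in Young's inequality is \<open>norm Z\<close>: the terms in
    \<open>v\<close> are quadratic in \<open>Z\<close>, so both parts end up linear in
    \<open>norm Z\<close>.\<close>
  also have "\<dots> \<le> ((v \<bullet> (R *v v)) / norm Z + norm Z * (k \<bullet> (R *v k)))
      + (((B *v v) \<bullet> (P K *v (B *v v))) / norm Z + norm Z * (m \<bullet> (P K *v m)))"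
    by (intro add_mono psd_young[OF _ _ z] pos_def_psd[OF R] symR psd_P[OF st] sym_P[OF st])
  also have "\<dots> = (v \<bullet> (R *v v) + (B *v v) \<bullet> (P K *v (B *v v))) / norm Z + norm Z * (x \<bullet> (P K *v x) - x \<bullet> (Q *v x))"
    using quadratic_P[OF st, of x] unfolding quadratic_W k_def[symmetric] m_def[symmetric]
    by (simp add: add_divide_distrib algebra_simps)
  also have "\<dots> \<le> (opnorm R + \<alpha> / \<mu> * (opnorm B)\<^sup>2) * (opnorm C)\<^sup>2 * (norm Z)\<^sup>2 * (norm x)\<^sup>2 / norm Z
      + norm Z * (\<alpha> / \<mu> * (norm x)\<^sup>2 - x \<bullet> (Q *v x))"
    unfolding v_def using z quadratic_P_le[of x]
    by (intro add_mono divide_right_mono quadratic_Z mult_left_mono) auto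
  also have "\<dots> = norm Z * (c * (norm x)\<^sup>2 - x \<bullet> (Q *v x))"
    using z mu_pos by (simp add: c_def power2_eq_square field_simps)
  also have "\<dots> \<le> norm Z * (c * (x \<bullet> (Q *v x) / \<sigma>) - x \<bullet> (Q *v x))"
    using z \<open>c \<ge> 0\<close> sigma_pos pos_def_sigma_min_le[OF Q, of x]
    by (intro mult_left_mono diff_right_mono) (auto simp: pos_le_divide_eq mult.commute)
  also have "\<dots> = norm Z * \<zeta> * (x \<bullet> (Q *v x))"
    unfolding zeta1_def c_def[symmetric] by (simp add: algebra_simps)
  finally show ?thesis .
qed

lemma zeta_nonneg:
  assumes "Z \<noteq> 0"
  shows "0 \<le> \<zeta>"
proof -
  let ?x = "axis undefined 1 :: real^'n"
  have "0 < ?x \<bullet> (Q *v ?x)" using Q by (simp add: pos_def_def axis_eq_0_iff)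
  moreover have "0 \<le> norm Z * \<zeta> * (?x \<bullet> (Q *v ?x))" using N_bound[OF assms, of ?x] abs_ge_zero by linarith
  ultimately have "0 \<le> norm Z * \<zeta>" by (simp add: zero_le_mult_iff)
  then show ?thesis using assms by (simp add: zero_le_mult_iff)
qed

text \<open>\<open>N\<close> and its negative are both dominated by norm Z * \<zeta> times the stage
  cost. Since \<open>lyap\<close> preserves semidefiniteness, \<open>P'\<close> and its negative are
  dominated by the same multiple of \<open>P\<close>.\<close>

lemma P'_bound:
  assumes "Z \<noteq> 0"
  shows "\<bar>x \<bullet> (P' K Z *v x)\<bar> \<le> norm Z * \<zeta> * (\<alpha> / \<mu>) * (norm x)\<^sup>2"
proof -
  have zz: "0 \<le> norm Z * \<zeta>" using zeta_nonneg[OF assms] by simp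
  have QW: "x \<bullet> (Q *v x) \<le> x \<bullet> (W K *v x)" for x
    using psdD[OF pos_def_psd[OF R]] by (simp add: quadratic_W)
  have NW: "\<bar>x \<bullet> (N K Z *v x)\<bar> \<le> norm Z * \<zeta> * (x \<bullet> (W K *v x))" for x
    using N_bound[OF assms, of x] mult_left_mono[OF QW zz, of x] by linarith
  have eq: "lyap (transpose (M K)) ((norm Z * \<zeta>) *\<^sub>R W K + c *\<^sub>R N K Z) = (norm Z * \<zeta>) *\<^sub>R P K + c *\<^sub>R P' K Z" for c
    by (simp add: P_def P'_def linear_add[OF linear_lyap[OF st'[OF st]]] linear_cmul[OF linear_lyap[OF st'[OF st]]])
  have "psd ((norm Z * \<zeta>) *\<^sub>R W K + c *\<^sub>R N K Z)" if "\<bar>c\<bar> = 1" for c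
    unfolding psd_def
  proof
    fix x
    have "- (c * (x \<bullet> (N K Z *v x))) \<le> \<bar>x \<bullet> (N K Z *v x)\<bar>" using that by (auto simp: abs_if split: if_splits)
    then show "0 \<le> x \<bullet> (((norm Z * \<zeta>) *\<^sub>R W K + c *\<^sub>R N K Z) *v x)"
      using NW[of x] by (simp add: matrix_vector_mult_add_rdistrib scaleR_matrix_vector inner_add_right)
  qed
  from psd_lyap[OF st'[OF st] this] have "psd ((norm Z * \<zeta>) *\<^sub>R P K + c *\<^sub>R P' K Z)" if "\<bar>c\<bar> = 1" for c
    using that eq by metis
  from psdD[OF this[of 1], of x] psdD[OF this[of "-1"], of x]
  have "\<bar>x \<bullet> (P' K Z *v x)\<bar> \<le> norm Z * \<zeta> * (x \<bullet> (P K *v x))"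
    by (simp add: matrix_vector_mult_add_rdistrib matrix_vector_mult_diff_rdistrib scaleR_matrix_vector
        inner_add_right inner_diff_right abs_le_iff)
  also have "\<dots> \<le> norm Z * \<zeta> * (\<alpha> / \<mu> * (norm x)\<^sup>2)" by (intro mult_left_mono quadratic_P_le zz)
  finally show ?thesis by (simp add: mult.assoc)
qed

text \<open>With \<open>S K\<close> written as a sum of u u^T, the term is a sum of bilinear values
  at B Z C u and M u. The product |u| |M u| is split into squares, whose sums are the traces of S
  and of M S M^T = S - X0.\<close>

lemma cross_term_bound:
  assumes "Z \<noteq> 0"
  shows "- (P' K Z \<bullet> (B ** Z ** C ** S K ** transpose (M K)))
    \<le> norm Z * \<zeta> * (\<alpha> / \<mu>) * (opnorm B * opnorm C * norm Z) * (S K \<bullet> mat 1)"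
proof -
  define c where "c = norm Z * \<zeta> * (\<alpha> / \<mu>)"
  define \<beta> where "\<beta> = opnorm B * opnorm C * norm Z"
  have c: "c \<ge> 0" using zeta_nonneg[OF assms] alpha_nonneg mu_pos by (simp add: c_def)
  have b: "\<beta> \<ge> 0" by (simp add: \<beta>_def opnorm_nonneg)
  obtain u and n :: nat where u: "S K = (\<Sum>k<n. outer (u k))"
    using psd_eq_sum_outer[OF psd_S[OF st] sym_S[OF st]] by blast
  let ?BV = "B ** Z ** C"
  have "?BV ** S K ** transpose (M K) = (\<Sum>k<n. dyad (?BV *v u k) (M K *v u k))"
    unfolding u bounded_bilinear.sum_right[OF bounded_bilinear_matrix_mult]
      bounded_bilinear.sum_left[OF bounded_bilinear_matrix_mult]
    by (simp add: outer_eq_dyad mult_dyad)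
  then have "- (P' K Z \<bullet> (?BV ** S K ** transpose (M K)))
      = (\<Sum>k<n. (- (?BV *v u k)) \<bullet> (P' K Z *v (M K *v u k)))"
    by (simp add: inner_sum_right inner_dyad sum_negf)
  also have "\<dots> \<le> (\<Sum>k<n. c * (\<beta> * (((norm (u k))\<^sup>2 + (norm (M K *v u k))\<^sup>2) / 2)))"
  proof (rule sum_mono)
    fix k
    have nb: "norm (?BV *v x) \<le> \<beta> * norm x" for x
    proof -
      have "norm (B *v ((Z ** C) *v x)) \<le> opnorm B * norm ((Z ** C) *v x)" by (rule norm_mult_le_opnorm)
      also have "\<dots> \<le> opnorm B * (norm Z * opnorm C * norm x)" by (intro mult_left_mono norm_ZC opnorm_nonneg)
      finally show ?thesis by (simp add: \<beta>_def matrix_vector_mul_assoc matrix_mul_assoc mult_ac)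
    qed
    have "(- (?BV *v u k)) \<bullet> (P' K Z *v (M K *v u k)) \<le> c * (norm (- (?BV *v u k)) * norm (M K *v u k))"
      unfolding c_def by (rule sym_bilinear_le[OF sym_P'[OF st] P'_bound[OF assms]])
    also have "\<dots> \<le> c * ((\<beta> * norm (u k)) * norm (M K *v u k))"
      using nb[of "u k"] by (intro mult_left_mono mult_right_mono c) auto
    also have "\<dots> = c * (\<beta> * (norm (u k) * norm (M K *v u k)))" by (simp add: mult.assoc)
    also have "\<dots> \<le> c * (\<beta> * (((norm (u k))\<^sup>2 + (norm (M K *v u k))\<^sup>2) / 2))"
      using sum_squares_bound[of "norm (u k)" "norm (M K *v u k)"]
      by (intro mult_left_mono b c) (simp add: mult.assoc)
    finally show "(- (?BV *v u k)) \<bullet> (P' K Z *v (M K *v u k))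
      \<le> c * (\<beta> * (((norm (u k))\<^sup>2 + (norm (M K *v u k))\<^sup>2) / 2))" .
  qed
  also have "\<dots> = c * (\<beta> * (((\<Sum>k<n. (norm (u k))\<^sup>2) + (\<Sum>k<n. (norm (M K *v u k))\<^sup>2)) / 2))"
    by (simp only: sum_distrib_left[symmetric] sum_divide_distrib[symmetric] sum.distrib)
  also have "\<dots> \<le> c * (\<beta> * ((S K \<bullet> mat 1 + S K \<bullet> mat 1) / 2))"
  proof (intro mult_left_mono divide_right_mono add_mono b c)
    show "(\<Sum>k<n. (norm (u k))\<^sup>2) \<le> S K \<bullet> mat 1"
      by (simp add: u inner_sum_left inner_outer power2_norm_eq_inner)
    have "congr (M K) (S K) = (\<Sum>k<n. congr (M K) (outer (u k)))"
      unfolding u by (rule linear_sum[OF linear_congr])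
    then have "congr (M K) (S K) = (\<Sum>k<n. outer (M K *v u k))"
      by (simp add: congr_def outer_eq_dyad mult_dyad)
    then have "(\<Sum>k<n. (norm (M K *v u k))\<^sup>2) = congr (M K) (S K) \<bullet> mat 1"
      by (simp add: inner_sum_left inner_outer power2_norm_eq_inner)
    also have "\<dots> = S K \<bullet> mat 1 - X0 \<bullet> mat 1"
      using lyap_eq[OF st, of X0] unfolding S_def[symmetric] by (metis add_diff_cancel_left' inner_diff_left)
    also have "\<dots> \<le> S K \<bullet> mat 1"
      using inner_psd_nonneg[OF pos_def_psd[OF X0] symX0 psd_mat_1] by simp
    finally show "(\<Sum>k<n. (norm (M K *v u k))\<^sup>2) \<le> S K \<bullet> mat 1" .
  qed simp
  finally show ?thesis unfolding c_def \<beta>_def by simp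
qed

lemma curvature_le:
  assumes "Z \<noteq> 0"
  shows "curvature K Z \<le> L * (norm Z)\<^sup>2"
proof -
  define r where "r = (opnorm R + \<alpha> / \<mu> * (opnorm B)\<^sup>2) * (opnorm C)\<^sup>2"
  define s where "s = S K \<bullet> mat 1"
  define q where "q = 2 * r + 4 * (\<zeta> * (\<alpha> / \<mu>) * (opnorm B * opnorm C))"
  have "0 \<le> \<alpha> / \<mu>" using alpha_nonneg mu_pos by simp
  then have "q \<ge> 0" unfolding q_def r_def
    by (intro add_nonneg_nonneg mult_nonneg_nonneg opnorm_nonneg zeta_nonneg[OF assms]) simp_all
  \<comment> \<open>\<open>L\<close> has the product of these two norms in a denominator; positivity
    lets it cancel against their squares.\<close>
  have bc: "opnorm B > 0" "opnorm C > 0" using B0 C0 by (simp_all add: opnorm_pos)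
  have "S K \<bullet> (transpose (Z ** C) ** R ** (Z ** C) + transpose (B ** Z ** C) ** P K ** (B ** Z ** C)) \<le> r * (norm Z)\<^sup>2 * s"
    unfolding s_def
  proof (rule trace_inner_le[OF psd_S[OF st] sym_S[OF st]])
    fix x
    show "x \<bullet> ((transpose (Z ** C) ** R ** (Z ** C) + transpose (B ** Z ** C) ** P K ** (B ** Z ** C)) *v x)
        \<le> r * (norm Z)\<^sup>2 * (norm x)\<^sup>2"
      using quadratic_Z[of x] unfolding matrix_vector_mult_add_rdistrib inner_add_right quadratic_conj
      by (simp add: r_def matrix_vector_mul_assoc matrix_mul_assoc)
  qed
  then have "curvature K Z \<le> 2 * (r * (norm Z)\<^sup>2 * s) + 4 * (norm Z * \<zeta> * (\<alpha> / \<mu>) * (opnorm B * opnorm C * norm Z) * s)"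
    using cross_term_bound[OF assms] unfolding curvature_def s_def by linarith
  also have "\<dots> = q * (norm Z)\<^sup>2 * s" by (simp add: q_def power2_eq_square algebra_simps)
  also have "\<dots> \<le> q * (norm Z)\<^sup>2 * (\<alpha> / \<sigma>)"
    unfolding s_def using \<open>q \<ge> 0\<close> by (intro mult_left_mono trace_S_le) auto
  also have "\<dots> = L * (norm Z)\<^sup>2"
    using bc mu_pos sigma_pos by (simp add: smooth_const_def q_def r_def power2_eq_square field_simps)
  finally show ?thesis .
qed

end

end

end

section \<open>Descent and gradient domination\<close>

text \<open>The rows of X F^T are the images under \<open>F\<close> of the rows of \<open>X\<close>,
  and the squared Frobenius norm adds up squared row norms.\<close>

lemma norm_matrix_mult_ge:
  fixes F :: "real^'n^'m" and X :: "real^'n^'k"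
  assumes "\<And>x. c * norm x \<le> norm (F *v x)" "0 \<le> c"
  shows "c * norm X \<le> norm (X ** transpose F)"
proof -
  have row: "(X ** transpose F) $ i = F *v (X $ i)" for i
    by (simp add: vec_eq_iff matrix_matrix_mult_def matrix_vector_mult_def transpose_def mult.commute)
  have "c * norm X = L2_set (\<lambda>i. c * norm (X $ i)) UNIV"
    using assms(2) by (simp add: norm_vec_def[of X] L2_set_right_distrib)
  also have "\<dots> \<le> norm (X ** transpose F)"
    unfolding norm_vec_def[of "X ** transpose F"] row using assms by (intro L2_set_mono) auto
  finally show ?thesis .
qed

text \<open>Replacing 1 - c by the larger exp (- c) avoids powers of 1 - c, which might be
  negative.\<close>

lemma linear_rate:
  fixes \<delta> :: "nat \<Rightarrow> real"
  assumes "\<And>i. 0 \<le> \<delta> i" "\<And>i. \<delta> (Suc i) \<le> (1 - c) * \<delta> i" "0 < c" "0 < \<epsilon>"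
    and N: "1 / c * ln (\<delta> 0 / \<epsilon>) \<le> real N"
  shows "\<delta> N \<le> \<epsilon>"
proof -
  have le: "\<delta> i \<le> exp (- c * real i) * \<delta> 0" for i
  proof (induction i)
    case (Suc i)
    have "1 - c \<le> exp (- c)" using exp_ge_add_one_self[of "- c"] by simp
    then have "(1 - c) * \<delta> i \<le> exp (- c) * \<delta> i" using assms(1) by (rule mult_right_mono)
    also have "\<dots> \<le> exp (- c) * (exp (- c * real i) * \<delta> 0)" by (intro mult_left_mono Suc) simp
    also have "\<dots> = exp (- c * real (Suc i)) * \<delta> 0"
      by (simp add: distrib_left exp_add[symmetric] mult.assoc[symmetric] algebra_simps)
    finally show ?case using assms(2)[of i] by linarith
  qed simp
  show ?thesis
  \<comment> \<open>For \<delta> 0 = 0 the logarithm is only a default value, but then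
    \<open>le\<close> alone gives the claim.\<close>
  proof (cases "\<delta> 0 = 0")
    case True
    then show ?thesis using le[of N] assms(4) by simp
  next
    case False
    then have d: "\<delta> 0 > 0" using assms(1)[of 0] by simp
    have "ln (\<delta> 0 / \<epsilon>) \<le> c * real N" using N assms(3) by (simp add: pos_divide_le_eq mult.commute)
    then have "exp (ln (\<delta> 0 / \<epsilon>)) \<le> exp (c * real N)" by simp
    then have "\<delta> 0 / \<epsilon> \<le> exp (c * real N)" using d assms(4) by simp
    then have "exp (- c * real N) * \<delta> 0 \<le> \<epsilon>"
      using assms(4) by (simp add: exp_minus field_simps)
    then show ?thesis using le[of N] by linarith
  qed
qed

context sof
begin

text \<open>Taylor estimates without integration: slope and cost minus their claimed bounds are
  nonincreasing. The whole segment must lie in the sublevel set, because \<open>curvature_le\<close>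
  applies only there.\<close>

lemma line_bounds:
  assumes t: "0 \<le> t" and Z: "Z \<noteq> 0"
    and good: "\<And>s. 0 \<le> s \<Longrightarrow> s \<le> t \<Longrightarrow> stab (K + s *\<^sub>R Z) \<and> J (K + s *\<^sub>R Z) \<le> \<alpha>"
  shows "Z \<bullet> grad (K + t *\<^sub>R Z) \<le> Z \<bullet> grad K + L * (norm Z)\<^sup>2 * t"
    and "J (K + t *\<^sub>R Z) \<le> J K + t * (Z \<bullet> grad K) + L * (norm Z)\<^sup>2 * t\<^sup>2 / 2"
proof -
  define k where "k s = K + s *\<^sub>R Z" for s
  define f where "f s = S (k s) \<bullet> N (k s) Z" for s
  have stk: "stab (k s)" "J (k s) \<le> \<alpha>" if "0 \<le> s" "s \<le> t" for s
    using good[OF that] by (auto simp: k_def)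
  have f_eq: "f s = Z \<bullet> grad (k s)" if "0 \<le> s" "s \<le> t" for s
    unfolding f_def by (rule slope_eq[OF stk(1)[OF that]])
  have f0: "f 0 = Z \<bullet> grad K" using f_eq[of 0] t by (simp add: k_def)
  have df: "(f has_real_derivative curvature (k s) Z) (at s)" if s: "0 \<le> s" "s \<le> t" for s
  proof -
    obtain f' where f': "((\<lambda>K. S K \<bullet> N K Z) has_derivative f') (at (k s))" "f' Z = curvature (k s) Z"
      using has_derivative_slope[OF stk(1)[OF s]] by blast
    from has_derivative_line[OF f'(1)[unfolded k_def]] show ?thesis
      unfolding f_def[abs_def] k_def f'(2)[unfolded k_def] .
  qed
  have dJ: "((\<lambda>s. J (k s)) has_real_derivative f s) (at s)" if "0 \<le> s" "s \<le> t" for s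
    using has_derivative_line[OF has_derivative_J[OF stk(1)[OF that], unfolded k_def]]
    unfolding f_eq[OF that] k_def .
  have first: "f s \<le> f 0 + L * (norm Z)\<^sup>2 * s" if "0 \<le> s" "s \<le> t" for s
  proof -
    have "f s - L * (norm Z)\<^sup>2 * s \<le> f 0 - L * (norm Z)\<^sup>2 * 0"
    proof (rule DERIV_nonpos_imp_nonincreasing[OF that(1)])
      fix x assume x: "0 \<le> x" "x \<le> s"
      then have xt: "x \<le> t" using that by simp
      have "((\<lambda>s. f s - L * (norm Z)\<^sup>2 * s) has_real_derivative curvature (k x) Z - L * (norm Z)\<^sup>2) (at x)"
        by (auto intro!: derivative_eq_intros df x xt)
      then show "\<exists>y. ((\<lambda>s. f s - L * (norm Z)\<^sup>2 * s) has_real_derivative y) (at x) \<and> y \<le> 0"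
        using curvature_le[OF stk[OF x(1) xt] Z] by (intro exI conjI) auto
    qed
    then show ?thesis by simp
  qed
  from first[OF t order_refl]
  show "Z \<bullet> grad (K + t *\<^sub>R Z) \<le> Z \<bullet> grad K + L * (norm Z)\<^sup>2 * t"
    unfolding f_eq[OF t order_refl] f0 k_def .
  have "J (k t) - t * f 0 - L * (norm Z)\<^sup>2 * t\<^sup>2 / 2 \<le> J (k 0) - 0 * f 0 - L * (norm Z)\<^sup>2 * 0\<^sup>2 / 2"
  proof (rule DERIV_nonpos_imp_nonincreasing[OF t])
    fix x assume x: "0 \<le> x" "x \<le> t"
    have "((\<lambda>s. J (k s) - s * f 0 - L * (norm Z)\<^sup>2 * s\<^sup>2 / 2) has_real_derivative
        f x - f 0 - L * (norm Z)\<^sup>2 * x) (at x)"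
      by (auto intro!: derivative_eq_intros dJ x)
    then show "\<exists>y. ((\<lambda>s. J (k s) - s * f 0 - L * (norm Z)\<^sup>2 * s\<^sup>2 / 2) has_real_derivative y) (at x) \<and> y \<le> 0"
      using first[OF x] by (intro exI conjI) auto
  qed
  then show "J (K + t *\<^sub>R Z) \<le> J K + t * (Z \<bullet> grad K) + L * (norm Z)\<^sup>2 * t\<^sup>2 / 2"
    by (simp add: k_def f0)
qed

lemma stab_line_nhds:
  assumes "stab (K + T *\<^sub>R Z)"
  shows "\<forall>\<^sub>F s in nhds T. stab (K + s *\<^sub>R Z)"
proof -
  have "isCont (\<lambda>s. M (K + s *\<^sub>R Z)) T"
    by (rule isCont_o2[OF _ isCont_M]) (intro continuous_intros)
  then have "((\<lambda>s. M (K + s *\<^sub>R Z)) \<longlongrightarrow> M (K + T *\<^sub>R Z)) (nhds T)"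
    by (simp add: isCont_def tendsto_nhds_iff)
  then show ?thesis by (rule eventually_compose_filterlim[OF eventually_schur_stable[OF assms]])
qed

text \<open>
  The sublevel set is closed because the bound on the partial sums of squared states is uniform
  on it and survives limits; a segment can therefore not leave it without a previous exit value
  \<open>J > \<alpha>\<close>, which the strictly negative slope excludes.
\<close>

lemma gradient_step:
  assumes st: "stab K" "J K \<le> \<alpha>" and L: "0 < L" and \<eta>: "\<eta> \<le> 1 / L" and t: "0 \<le> t" "t \<le> \<eta>"
  shows "stab (K - t *\<^sub>R grad K) \<and> J (K - t *\<^sub>R grad K) \<le> J K - t / 2 * (norm (grad K))\<^sup>2"
proof (cases "grad K = 0")
  case True
  then show ?thesis using st by simp
next
  case False
  define Z where "Z = - grad K"
  have Z: "Z \<noteq> 0" using False by (simp add: Z_def)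
  define k where "k s = K + s *\<^sub>R Z" for s
  define good where "good s \<longleftrightarrow> stab (k s) \<and> J (k s) \<le> \<alpha>" for s
  \<comment> \<open>Requiring all earlier parameters to be good makes this an interval from 0, so
    everything below its supremum is good.\<close>
  define I where "I = {s. 0 \<le> s \<and> s \<le> \<eta> \<and> (\<forall>r. 0 \<le> r \<longrightarrow> r \<le> s \<longrightarrow> good r)}"
  have slope0: "Z \<bullet> grad K = - (norm Z)\<^sup>2" by (simp add: Z_def power2_norm_eq_inner)
  have \<eta>0: "0 \<le> \<eta>" using t by simp
  have "good 0" using st by (simp add: good_def k_def)
  then have I0: "0 \<in> I" using \<eta>0 by (auto simp: I_def)
  have bdd: "bdd_above I" by (rule bdd_aboveI[of _ \<eta>]) (simp add: I_def)
  define T where "T = Sup I"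
  have T0: "0 \<le> T" unfolding T_def by (rule cSup_upper[OF I0 bdd])
  have T\<eta>: "T \<le> \<eta>" unfolding T_def using I0 by (intro cSup_least) (auto simp: I_def)
  have below: "good s" if s: "0 \<le> s" "s < T" for s
  proof -
    obtain r where "r \<in> I" "s < r"
      by (rule less_cSupE[OF s(2)[unfolded T_def]]) (use I0 in blast)+
    then show ?thesis using s by (auto simp: I_def)
  qed
  have "good T"
  proof (cases "T = 0")
    case True
    then show ?thesis using \<open>good 0\<close> by simp
  next
    case False
    then have Tpos: "0 < T" using T0 by simp
    have ev: "\<forall>\<^sub>F s in at_left T. good s"
      using eventually_at_left_real[OF Tpos]
    proof (rule eventually_mono)
      show "good s" if "s \<in> {0<..<T}" for s using that by (intro below) auto
    qed
    have "isCont (\<lambda>s. M (k s)) T"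
      unfolding k_def by (rule isCont_o2[OF _ isCont_M]) (intro continuous_intros)
    then have lim: "((\<lambda>s. M (k s)) \<longlongrightarrow> M (k T)) (at_left T)"
      unfolding isCont_def by (rule tendsto_mono[OF at_le, rotated]) simp
    have bound: "\<forall>\<^sub>F s in at_left T. \<forall>x n. (\<Sum>i<n. (norm (state (M (k s)) x i))\<^sup>2) \<le> \<alpha> / \<mu> * (norm x)\<^sup>2 / \<sigma>"
      using ev
    proof (rule eventually_mono)
      fix s assume "good s"
      then have "stab (k s)" "J (k s) \<le> \<alpha>" by (simp_all add: good_def)
      from state_bound[OF this]
      show "\<forall>x n. (\<Sum>i<n. (norm (state (M (k s)) x i))\<^sup>2) \<le> \<alpha> / \<mu> * (norm x)\<^sup>2 / \<sigma>" by blast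
    qed
    have sT: "stab (k T)" by (rule schur_stable_limit[OF lim _ bound]) simp
    have "isCont (\<lambda>s. J (k s)) T"
      using has_derivative_line[OF has_derivative_J[OF sT, unfolded k_def]]
      unfolding k_def by (rule DERIV_isCont)
    then have "((\<lambda>s. J (k s)) \<longlongrightarrow> J (k T)) (at_left T)"
      unfolding isCont_def by (rule tendsto_mono[OF at_le, rotated]) simp
    then have "J (k T) \<le> \<alpha>"
      by (rule tendsto_upperbound) (use ev in \<open>auto simp: good_def elim: eventually_mono\<close>)
    with sT show ?thesis by (simp add: good_def)
  qed
  then have upto: "good s" if "0 \<le> s" "s \<le> T" for s
    using below that by (cases "s = T") auto
  have "T = \<eta>"
  proof (rule ccontr)
    assume "T \<noteq> \<eta>"
    then have T_less: "T < \<eta>" using T\<eta> by simp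
    \<comment> \<open>Strictness matters: at T = 1 / L the slope would only be bounded by zero,
      while T < \<eta> leaves a strict decrease, so the segment can be continued.\<close>
    then have "L * T < L * (1 / L)" using \<eta> L by (intro mult_strict_left_mono) auto
    then have "L * T < 1" using L by simp
    have "stab (K + s *\<^sub>R Z) \<and> J (K + s *\<^sub>R Z) \<le> \<alpha>" if "0 \<le> s" "s \<le> T" for s
      using upto[OF that] by (simp add: good_def k_def)
    from line_bounds(1)[OF T0 Z this]
    have "Z \<bullet> grad (k T) \<le> - (norm Z)\<^sup>2 + L * (norm Z)\<^sup>2 * T"
      by (simp add: k_def slope0)
    also have "\<dots> = (norm Z)\<^sup>2 * (L * T - 1)" by (simp add: algebra_simps)
    also have "\<dots> < 0" using \<open>L * T < 1\<close> Z by (simp add: mult_less_0_iff)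
    finally have neg: "Z \<bullet> grad (k T) < 0" .
    have sT: "stab (k T)" "J (k T) \<le> \<alpha>" using \<open>good T\<close> by (auto simp: good_def)
    have "((\<lambda>s. J (k s)) has_real_derivative Z \<bullet> grad (k T)) (at T)"
      using has_derivative_line[OF has_derivative_J[OF sT(1), unfolded k_def]] unfolding k_def .
    from DERIV_neg_dec_right[OF this neg] obtain d where d: "d > 0"
      "\<And>h. h > 0 \<Longrightarrow> h < d \<Longrightarrow> J (k (T + h)) < J (k T)" by blast
    from stab_line_nhds[OF sT(1)[unfolded k_def]] obtain e where e: "e > 0"
      "\<And>s. dist s T < e \<Longrightarrow> stab (k s)" by (auto simp: eventually_nhds_metric k_def)
    define h where "h = min (min (d / 2) (e / 2)) (\<eta> - T)"
    have h: "h > 0" "h < d" "h < e" "T + h \<le> \<eta>" using d(1) e(1) T_less by (auto simp: h_def)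
    have "good r" if r: "0 \<le> r" "r \<le> T + h" for r
    proof (cases "r \<le> T")
      case False
      then have "stab (k r)" using r h by (intro e(2)) (auto simp: dist_real_def)
      moreover have "J (k r) < J (k T)" using d(2)[of "r - T"] False r h by simp
      ultimately show ?thesis using sT by (simp add: good_def)
    qed (use r upto in auto)
    then have "T + h \<in> I" using T0 h by (auto simp: I_def)
    then have "T + h \<le> T" unfolding T_def by (rule cSup_upper[OF _ bdd])
    then show False using h by simp
  qed
  then have g: "good s" if "0 \<le> s" "s \<le> \<eta>" for s using upto that by simp
  have eq: "K - t *\<^sub>R grad K = k t" by (simp add: k_def Z_def)
  have "J (k t) \<le> J K + t * (Z \<bullet> grad K) + L * (norm Z)\<^sup>2 * t\<^sup>2 / 2"
    unfolding k_def using t g by (intro line_bounds(2)[OF t(1) Z]) (auto simp: good_def k_def)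
  also have "\<dots> = J K - t * (norm Z)\<^sup>2 + (L * t) * t * (norm Z)\<^sup>2 / 2"
    unfolding slope0 by (simp add: power2_eq_square)
  \<comment> \<open>Since L t \<le> 1, the curvature term costs at most half of the first-order
    decrease.\<close>
  also have "\<dots> \<le> J K - t * (norm Z)\<^sup>2 + 1 * t * (norm Z)\<^sup>2 / 2"
  proof -
    have "L * t \<le> L * (1 / L)" using t \<eta> L by (intro mult_left_mono) auto
    then have "L * t \<le> 1" using L by simp
    then show ?thesis using t by (intro add_left_mono divide_right_mono mult_right_mono) auto
  qed
  finally have "J (k t) \<le> J K - t / 2 * (norm (grad K))\<^sup>2" by (simp add: Z_def)
  then show ?thesis using g[OF t] by (simp add: eq good_def)
qed

text \<open>The bracket is the one-step loss from using \<open>K'\<close> once and \<open>K\<close>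
  afterwards, measured by the cost-to-go of \<open>K\<close>; \<open>S K'\<close> adds it up along
  the trajectories of \<open>K'\<close>. The identity is exact, however far apart the gains
  are.\<close>

lemma cost_difference:
  assumes "stab K" "stab K'"
  shows "J K' - J K = S K' \<bullet> (W K' + congr (transpose (M K')) (P K) - P K)"
proof -
  note st = schur_stable_transpose[OF assms(2)]
  have "P K' - P K = lyap (transpose (M K')) (W K') - lyap (transpose (M K')) (P K - congr (transpose (M K')) (P K))"
    unfolding lyap_unique[OF st] P_def ..
  also have "\<dots> = lyap (transpose (M K')) (W K' + congr (transpose (M K')) (P K) - P K)"
    by (subst linear_diff[OF linear_lyap[OF st], symmetric]) (simp add: algebra_simps)
  finally show ?thesis unfolding J_def S_inner[OF assms(2)] by (simp flip: inner_diff_right)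
qed

text \<open>The deviation v = (K' - K) C x enters the cost difference as 2 v . E x + v . (R + B^T P
  B) v. Completing the square bounds this below by - |E x|^2 / sigma_min R, whatever
  \<open>K'\<close> is.\<close>

lemma gradient_domination_E:
  assumes "stab K" "stab K'"
  shows "J K - J K' \<le> opnorm (S K') / sigma_min R * (norm (E K))\<^sup>2"
proof -
  let ?D = "W K' + congr (transpose (M K')) (P K) - P K"
  let ?r = "sigma_min R"
  have r: "?r > 0" by (rule pos_def_sigma_min_pos[OF R])
  let ?EE = "transpose (E K) ** E K"
  have EE: "x \<bullet> (?EE *v x) = (norm (E K *v x))\<^sup>2" for x by (rule gram_quadratic)
  have "psd ((1 / ?r) *\<^sub>R ?EE + ?D)"
    unfolding psd_def
  proof
    fix x
    define v k m where "v = ((K' - K) ** C) *v x" and "k = K *v (C *v x)" and "m = M K *v x"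
    have k': "K' *v (C *v x) = k + v"
      by (simp add: v_def k_def matrix_diff_rdistrib matrix_vector_mult_diff_rdistrib matrix_vector_mul_assoc)
    have m': "M K' *v x = m - B *v v"
      by (simp add: m_def v_def M_def closed_loop_def matrix_diff_rdistrib
          matrix_vector_mult_diff_rdistrib matrix_vector_mult_diff_distrib matrix_vector_mul_assoc
          matrix_mul_assoc)
    have e: "E K *v x = R *v k - transpose B *v (P K *v m)"
      by (simp add: E_def k_def m_def matrix_vector_mult_diff_rdistrib matrix_vector_mul_assoc matrix_mul_assoc)
    have "x \<bullet> (?D *v x) = (k + v) \<bullet> (R *v (k + v)) + (m - B *v v) \<bullet> (P K *v (m - B *v v))
        - k \<bullet> (R *v k) - m \<bullet> (P K *v m)"
      using quadratic_P[OF assms(1), of x]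
      by (simp add: matrix_vector_mult_add_rdistrib matrix_vector_mult_diff_rdistrib inner_add_right
          inner_diff_right quadratic_congr quadratic_W k' m' k_def[symmetric] m_def[symmetric])
    also have "\<dots> = 2 * (v \<bullet> (E K *v x)) + v \<bullet> (R *v v) + (B *v v) \<bullet> (P K *v (B *v v))"
      using sym_inner_commute[OF symR, of k v] sym_inner_commute[OF sym_P[OF assms(1)], of m "B *v v"]
      by (simp add: e matrix_vector_right_distrib matrix_vector_mult_diff_distrib inner_add_left
          inner_add_right inner_diff_left inner_diff_right inner_commute[of "R *v k"]
          inner_commute[of "P K *v m"] inner_matrix_vector_left[of B v])
    also have "\<dots> \<ge> 2 * (v \<bullet> (E K *v x)) + ?r * (norm v)\<^sup>2"
      using pos_def_sigma_min_le[OF R, of v] psdD[OF psd_P[OF assms(1)], of "B *v v"] by simp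
    finally have D: "x \<bullet> (?D *v x) \<ge> 2 * (v \<bullet> (E K *v x)) + ?r * (norm v)\<^sup>2" .
    have "0 \<le> (E K *v x + ?r *\<^sub>R v) \<bullet> (E K *v x + ?r *\<^sub>R v)" by simp
    also have "\<dots> = (norm (E K *v x))\<^sup>2 + ?r * (2 * (v \<bullet> (E K *v x)) + ?r * (norm v)\<^sup>2)"
      unfolding power2_norm_eq_inner
      by (simp add: inner_add_left inner_add_right inner_commute algebra_simps)
    also have "\<dots> \<le> (norm (E K *v x))\<^sup>2 + ?r * (x \<bullet> (?D *v x))"
      using D r by (intro add_left_mono mult_left_mono) auto
    finally have "0 \<le> ((norm (E K *v x))\<^sup>2 + ?r * (x \<bullet> (?D *v x))) / ?r" using r by simp
    also have "\<dots> = x \<bullet> (((1 / ?r) *\<^sub>R ?EE + ?D) *v x)"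
      using r unfolding matrix_vector_mult_add_rdistrib[of "(1 / ?r) *\<^sub>R ?EE"] scaleR_matrix_vector inner_add_right[of x "(1 / ?r) *\<^sub>R _"]
        inner_scaleR_right EE by (simp add: add_divide_distrib)
    finally show "0 \<le> x \<bullet> (((1 / ?r) *\<^sub>R ?EE + ?D) *v x)" .
  qed
  from inner_psd_nonneg[OF psd_S[OF assms(2)] sym_S[OF assms(2)] this]
  have "J K - J K' \<le> (1 / ?r) * (S K' \<bullet> ?EE)"
    using cost_difference[OF assms] by (simp only: inner_add_right inner_scaleR_right)
  also have "S K' \<bullet> ?EE = ?EE \<bullet> S K'" by (rule inner_commute)
  \<comment> \<open>The roles are exchanged here: \<open>S K'\<close> is bounded by its operator
    norm, and the trace is taken of E^T E, which gives the squared Frobenius norm of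
    \<open>E\<close>.\<close>
  also have "\<dots> \<le> opnorm (S K') * (?EE \<bullet> mat 1)"
  proof (rule trace_inner_le[OF _ _ quadratic_le_opnorm])
    show "psd ?EE" by (simp only: psd_def EE) simp
    show "transpose ?EE = ?EE" by (simp add: matrix_transpose_mul)
  qed
  also have "?EE \<bullet> mat 1 = (norm (E K))\<^sup>2"
    by (simp add: inner_matrix_mult_left power2_norm_eq_inner)
  finally show ?thesis using r by (simp add: divide_right_mono mult_left_mono)
qed

text \<open>In grad = 2 E S C^T, right multiplication by S and by C^T shrinks the Frobenius norm at
  most by the factors \<mu> and \<open>sigma_min C\<close>. The dimension condition makes
  \<open>sigma_min C\<close> a lower bound for |C x| / |x|.\<close>

lemma norm_E_le_grad:
  assumes "stab K" "CARD('n) \<le> CARD('d)"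
  shows "2 * \<mu> * sigma_min C * norm (E K) \<le> norm (grad K)"
proof -
  have mS: "\<mu> * norm x \<le> norm (S K *v x)" for x
  proof (cases "x = 0")
    case False
    have "\<mu> * (norm x)\<^sup>2 \<le> norm x * norm (S K *v x)"
      using S_ge_X0[OF assms(1), of x] norm_cauchy_schwarz[of x "S K *v x"] by linarith
    then have "norm x * (\<mu> * norm x) \<le> norm x * norm (S K *v x)"
      by (simp add: power2_eq_square mult_ac)
    then show ?thesis using False by simp
  qed simp
  have c0: "0 \<le> sigma_min C" using sigma_min_attained[OF assms(2), of C] by metis
  have "\<mu> * norm (E K) \<le> norm (E K ** S K)"
    using norm_matrix_mult_ge[OF mS, of "E K"] mu_pos sym_S[OF assms(1)] by simp
  then have "sigma_min C * (\<mu> * norm (E K)) \<le> sigma_min C * norm (E K ** S K)"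
    by (rule mult_left_mono[OF _ c0])
  also have "\<dots> \<le> norm (E K ** S K ** transpose C)"
    by (rule norm_matrix_mult_ge[OF sigma_min_norm_le[OF assms(2)] c0])
  finally show ?thesis by (simp add: grad_def mult_ac)
qed

lemma gradient_domination:
  assumes "stab K" "stab K'" "CARD('n) \<le> CARD('d)" "0 < sigma_min C"
  shows "J K - J K' \<le> opnorm (S K') / (4 * \<mu>\<^sup>2 * (sigma_min C)\<^sup>2 * sigma_min R) * (norm (grad K))\<^sup>2"
proof -
  let ?c = "2 * \<mu> * sigma_min C"
  have c: "?c > 0" using mu_pos assms(4) by simp
  have r: "sigma_min R > 0" by (rule pos_def_sigma_min_pos[OF R])
  have "(?c * norm (E K))\<^sup>2 \<le> (norm (grad K))\<^sup>2"
    using c by (intro power_mono norm_E_le_grad[OF assms(1,3)]) auto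
  then have "(norm (E K))\<^sup>2 \<le> (norm (grad K))\<^sup>2 / ?c\<^sup>2"
    unfolding pos_le_divide_eq[OF zero_less_power[OF c]]
    by (simp only: power_mult_distrib mult.commute)
  then have "opnorm (S K') / sigma_min R * (norm (E K))\<^sup>2
      \<le> opnorm (S K') / sigma_min R * ((norm (grad K))\<^sup>2 / ?c\<^sup>2)"
    using r by (intro mult_left_mono) (auto simp: opnorm_nonneg)
  also have "\<dots> = opnorm (S K') / (4 * \<mu>\<^sup>2 * (sigma_min C)\<^sup>2 * sigma_min R) * (norm (grad K))\<^sup>2"
    by (simp add: power_mult_distrib mult_ac)
  finally show ?thesis using gradient_domination_E[OF assms(1,2)] by linarith
qed

lemma opnorm_S_pos:
  assumes "stab K"
  shows "0 < opnorm (S K)"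
proof (rule opnorm_pos)
  let ?x = "axis undefined 1 :: real^'n"
  have "0 < ?x \<bullet> (X0 *v ?x)" using X0 by (simp add: pos_def_def axis_eq_0_iff)
  show "S K \<noteq> 0" using S_ge_X0[OF assms, of ?x] mu_pos by auto
qed

end

section \<open>Policy gradient for static output feedback\<close>

lemma state_outer: "outer (state M x t) = (congr M ^^ t) (outer x)"
  by (simp add: outer_eq_dyad congr_funpow_dyad)

text \<open>For each initial state the series is a bounded linear function of
  \<open>outer x\<close>, so the expectation passes through it without a separate interchange of sum
  and integral.\<close>

lemma sof_cost_eq:
  assumes "integrable D outer" and st: "schur_stable (closed_loop A B C K)"
  shows "sof_cost A B C Q R D K = lyap (closed_loop A B C K) (second_moment D)
    \<bullet> (Q + transpose C ** transpose K ** R ** K ** C)"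
proof -
  let ?M = "closed_loop A B C K" and ?W = "Q + transpose C ** transpose K ** R ** K ** C"
  have "(\<Sum>t. state ?M x t \<bullet> (?W *v state ?M x t)) = lyap ?M (outer x) \<bullet> ?W" for x
  proof -
    have "state ?M x t \<bullet> (?W *v state ?M x t) = (congr ?M ^^ t) (outer x) \<bullet> ?W" for t
      by (simp only: inner_outer flip: state_outer)
    then show ?thesis
      unfolding lyap_def bounded_linear.suminf[OF bounded_linear_inner_left summable_congr[OF st]] by simp
  qed
  moreover have "(LINT x|D. lyap ?M (outer x) \<bullet> ?W) = lyap ?M (second_moment D) \<bullet> ?W"
    unfolding second_moment_def
    by (rule integral_bounded_linear[OF bounded_linear_compose[OF bounded_linear_inner_left bounded_linear_lyap[OF st]] assms(1)])
  ultimately show ?thesis by (simp add: sof_cost_def)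
qed

lemma state_corr_eq:
  assumes "integrable D outer" and st: "schur_stable (closed_loop A B C K)"
  shows "state_corr A B C D K = lyap (closed_loop A B C K) (second_moment D)"
  unfolding state_corr_def state_outer lyap_def[symmetric] second_moment_def
  by (rule integral_bounded_linear[OF bounded_linear_lyap[OF st] assms(1)])

lemma sf_cost_eq_sof_cost:
  assumes "K ** C = Ks"
  shows "sf_cost A B Q R D Ks = sof_cost A B C Q R D K"
proof -
  have step: "(\<lambda>y. A *v y + B *v (- (Ks *v y))) = (*v) (closed_loop A B C K)"
    by (simp add: fun_eq_iff closed_loop_def assms[symmetric] matrix_vector_mult_diff_rdistrib
        linear_neg[OF matrix_vector_mul_linear] matrix_vector_mul_assoc matrix_mul_assoc)
  have "x \<bullet> (Q *v x) + (- (Ks *v x)) \<bullet> (R *v (- (Ks *v x)))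
      = x \<bullet> ((Q + transpose C ** transpose K ** R ** K ** C) *v x)" for x
    using quadratic_conj[of x Ks R Ks x]
    by (simp add: linear_neg[OF matrix_vector_mul_linear] matrix_vector_mult_add_rdistrib
        inner_add_right assms[symmetric] matrix_transpose_mul matrix_mul_assoc)
  then show ?thesis unfolding sf_cost_def sof_cost_def step state_def Let_def by simp
qed

text \<open>A left inverse C' of \<open>C\<close> turns each state feedback Ks into the output gain
  Ks C', so both problems range over the same closed loops.\<close>

lemma sf_opt_cost_eq_sof_minimum:
  fixes C :: "real^'n^'d"
  assumes "CARD('d) = CARD('n)" "rank C = CARD('n)"
    and min: "is_arg_min (sof_cost A B C Q R D) (\<lambda>K. K \<in> stabilizing A B C) Kstar"
  shows "sf_opt_cost A B Q R D = sof_cost A B C Q R D Kstar"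
proof -
  obtain C' where C': "C' ** C = mat 1"
    using assms(2) by (metis full_rank_injective matrix_left_invertible_injective)
  let ?S = "{Ks. spectral_radius (A - B ** Ks) < 1}"
  have stab: "K ** C \<in> ?S \<longleftrightarrow> K \<in> stabilizing A B C" for K
    by (simp add: stabilizing_def closed_loop_def matrix_mul_assoc)
  have min': "Kstar \<in> stabilizing A B C"
    "\<And>K. K \<in> stabilizing A B C \<Longrightarrow> sof_cost A B C Q R D Kstar \<le> sof_cost A B C Q R D K"
    using min by (auto simp: is_arg_min_def not_less)
  have "Inf (sf_cost A B Q R D ` ?S) = sof_cost A B C Q R D Kstar"
  proof (rule cInf_eq_minimum)
    show "sof_cost A B C Q R D Kstar \<in> sf_cost A B Q R D ` ?S"
      using sf_cost_eq_sof_cost[OF refl, of A B Q R D Kstar C] stab[of Kstar] min'(1) by (metis image_eqI)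
    fix c assume "c \<in> sf_cost A B Q R D ` ?S"
    then obtain Ks where Ks: "Ks \<in> ?S" "c = sf_cost A B Q R D Ks" by blast
    have eq: "(Ks ** C') ** C = Ks" using C' by (simp flip: matrix_mul_assoc)
    show "sof_cost A B C Q R D Kstar \<le> c"
      unfolding Ks(2) sf_cost_eq_sof_cost[OF eq] using stab[of "Ks ** C'"] Ks(1) unfolding eq
      by (intro min'(2)) simp
  qed
  then show ?thesis by (simp add: sf_opt_cost_def)
qed

text \<open>With B = 0 the origin could never be left. The norm of \<open>B\<close> stands in a
  denominator of the smoothness constant.\<close>

lemma controllable_nonzero:
  fixes A :: "real^'n^'n"
  assumes "controllable A B"
  shows "B \<noteq> 0"
proof
  assume B: "B = 0"
  obtain u and x :: "nat \<Rightarrow> real^'n" and N where x: "x 0 = 0"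
    "\<And>t. x (Suc t) = A *v x t + B *v u t" "x N = axis undefined 1"
    using assms unfolding controllable_def by metis
  have "x t = 0" for t by (induction t) (simp_all add: x B)
  then show False using x(3) by (simp add: axis_eq_0_iff)
qed

lemma lin_indep_rows_nonzero:
  fixes C :: "real^'n^'d"
  assumes "lin_indep_rows C"
  shows "C \<noteq> 0"
proof
  assume "C = 0"
  then have "0 \<in> rows C" by (auto simp: rows_def row_def vec_eq_iff)
  then show False using assms dependent_zero by (auto simp: lin_indep_rows_def)
qed

context sof
begin

lemma sof_cost_eq_J:
  assumes "integrable D outer" "X0 = second_moment D" "stab K"
  shows "sof_cost A B C Q R D K = J K"
  using sof_cost_eq[OF assms(1) assms(3)[unfolded M_def], of Q R] J_eq[OF assms(3)]
  by (simp add: S_def W_def M_def flip: assms(2))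

lemma stabilizing_iff: "K \<in> stabilizing A B C \<longleftrightarrow> stab K"
  by (simp add: stabilizing_def spectral_radius_less_1_iff M_def)

text \<open>The cost is identified with \<open>J\<close> only at stabilizing gains; these form an
  open set, so the derivatives agree there.\<close>

lemma gradient_sof_cost:
  assumes "integrable D outer" "X0 = second_moment D" and st: "stab K"
  shows "gradient (sof_cost A B C Q R D) K = grad K"
proof -
  have "(M \<longlongrightarrow> M K) (nhds K)" using isCont_M by (simp add: isCont_def tendsto_nhds_iff)
  from eventually_compose_filterlim[OF eventually_schur_stable[OF st] this]
  have "\<forall>\<^sub>F K in nhds K. J K = sof_cost A B C Q R D K"
    by (rule eventually_mono) (simp add: sof_cost_eq_J[OF assms(1,2)])
  then have "(sof_cost A B C Q R D has_derivative (\<lambda>Z. Z \<bullet> grad K)) (at K)"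
    by (intro has_derivative_transform_eventually[OF has_derivative_J[OF st]])
      (auto simp: eventually_at_filter sof_cost_eq_J[OF assms] elim: eventually_mono)
  then have g: "GDERIV (sof_cost A B C Q R D) K :> grad K" by (simp add: gderiv_def)
  show ?thesis
    unfolding gradient_def
  proof (rule the_equality[where P = "\<lambda>g. GDERIV (sof_cost A B C Q R D) K :> g", OF g])
    fix g' assume "GDERIV (sof_cost A B C Q R D) K :> g'"
    with g have "(\<lambda>h. h \<bullet> g') = (\<lambda>h. h \<bullet> grad K)"
      unfolding gderiv_def by (rule has_derivative_unique[rotated])
    then show "g' = grad K" by (metis vector_eq_ldot)
  qed
qed

end

theorem theorem1:
  fixes A :: "real^'n^'n" and B :: "real^'m^'n" and C :: "real^'n^'d"
    and Q :: "real^'n^'n" and R :: "real^'m^'m"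
    and D :: "(real^'n) measure"
    and K :: "nat \<Rightarrow> real^'d^'m" and \<alpha> \<mu> L \<eta> :: real
  defines "\<mu> \<equiv> sigma_min (second_moment D)"
    and "L \<equiv> smooth_const B C Q R \<mu> \<alpha>"
  assumes "controllable A B" and "observable C A" and "lin_indep_rows C"
    and "pos_def Q" and "pos_def R"
    and "prob_space D" and "sets D = sets borel"
    and "integrable D outer" and "pos_def (second_moment D)"
    and "K 0 \<in> stabilizing A B C" and "sof_cost A B C Q R D (K 0) = \<alpha>"
    and "\<eta> \<in> {0<..1 / L}"
    and "\<forall>i. K (Suc i) = K i - \<eta> *\<^sub>R gradient (sof_cost A B C Q R D) (K i)"
  shows "(\<forall>i. sof_cost A B C Q R D (K (Suc i)) \<le> sof_cost A B C Q R D (K i)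
              \<and> K i \<in> sof_sublevel A B C Q R D \<alpha>)
    \<and> (\<forall>\<epsilon>>0. \<exists>i. real i \<le> 2 * \<alpha> / (\<eta> * \<epsilon>\<^sup>2)
              \<and> norm (gradient (sof_cost A B C Q R D) (K i)) \<le> \<epsilon>)
    \<and> (\<forall>i. closed_segment (K i) (K (Suc i)) \<subseteq> sof_sublevel A B C Q R D \<alpha>)
    \<and> (CARD('d) = CARD('n) \<and> rank C = CARD('n) \<longrightarrow>
        (\<forall>Kstar. is_arg_min (sof_cost A B C Q R D) (\<lambda>K'. K' \<in> stabilizing A B C) Kstar \<longrightarrow>
          (\<forall>\<epsilon>\<^sub>J>0. \<forall>N :: nat.
             real N \<ge> opnorm (state_corr A B C D Kstar)
                        / (2 * \<eta> * \<mu>\<^sup>2 * (sigma_min C)\<^sup>2 * sigma_min R)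
                      * ln ((sof_cost A B C Q R D (K 0) - sf_opt_cost A B Q R D) / \<epsilon>\<^sub>J)
             \<longrightarrow> sof_cost A B C Q R D (K N) - sf_opt_cost A B Q R D \<le> \<epsilon>\<^sub>J)))"
proof -
  let ?J = "sof_cost A B C Q R D"
  let ?g = "gradient ?J"
  interpret sof A B C Q R "second_moment D" \<alpha>
    using controllable_nonzero[OF assms(3)] lin_indep_rows_nonzero[OF assms(5)] assms(6,7,11)
    by unfold_locales
  note cost = sof_cost_eq_J[OF assms(10) refl]
  note gradient = gradient_sof_cost[OF assms(10) refl]
  have \<eta>: "0 < \<eta>" "\<eta> \<le> 1 / L" using assms(14) by auto
  \<comment> \<open>A step size \<eta> with 0 < \<eta> \<le> 1 / L forces 1 / L to be positive; L =
    0 is excluded because division by zero gives zero.\<close>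
  then have L: "0 < L" by (metis order_less_le_trans zero_less_divide_1_iff)
  have step: "K (Suc i) = K i - \<eta> *\<^sub>R ?g (K i)" for i using assms(15) by blast
  have segment: "stab (K i - t *\<^sub>R ?g (K i)) \<and>
      J (K i - t *\<^sub>R ?g (K i)) \<le> J (K i) - t / 2 * (norm (?g (K i)))\<^sup>2"
    if "stab (K i)" "J (K i) \<le> \<alpha>" "0 \<le> t" "t \<le> \<eta>" for i t
    using gradient_step[OF that(1,2) L[unfolded L_def \<mu>_def] \<eta>(2)[unfolded L_def \<mu>_def] that(3,4)]
    unfolding gradient[OF that(1)] .
  have inv: "stab (K i) \<and> J (K i) \<le> \<alpha>" for i
  proof (induction i)
    case 0
    have "stab (K 0)" using assms(12) stabilizing_iff by blast
    then show ?case using cost assms(13) by simp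
  next
    case (Suc i)
    then have "stab (K (Suc i)) \<and> J (K (Suc i)) \<le> J (K i) - \<eta> / 2 * (norm (?g (K i)))\<^sup>2"
      unfolding step using \<eta>(1) by (intro segment) auto
    moreover have "0 \<le> \<eta> / 2 * (norm (?g (K i)))\<^sup>2" using \<eta>(1) by simp
    ultimately show ?case using Suc by linarith
  qed
  have decr: "J (K (Suc i)) \<le> J (K i) - \<eta> / 2 * (norm (?g (K i)))\<^sup>2" for i
    unfolding step using segment[of i \<eta>] inv \<eta>(1) by simp
  have cost_K: "?J (K i) = J (K i)" for i using cost inv by blast
  have J0: "J (K 0) = \<alpha>" using assms(13) cost_K by simp
  have mono: "J (K (Suc i)) \<le> J (K i)" for i
  proof -
    have "0 \<le> \<eta> / 2 * (norm (?g (K i)))\<^sup>2" using \<eta>(1) by simp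
    then show ?thesis using decr[of i] by linarith
  qed
  have part1: "?J (K (Suc i)) \<le> ?J (K i) \<and> K i \<in> sof_sublevel A B C Q R D \<alpha>" for i
    using mono inv by (simp add: cost_K sof_sublevel_def stabilizing_iff)
  have part2: "\<exists>i. real i \<le> 2 * \<alpha> / (\<eta> * \<epsilon>\<^sup>2) \<and> norm (?g (K i)) \<le> \<epsilon>" if "\<epsilon> > 0" for \<epsilon>
  proof (rule ccontr)
    assume neg: "\<not> ?thesis"
    \<comment> \<open>The floor makes n + 1 exceed the bound. Large gradients at the iterates 0 to n
      would give n + 1 decreases of \<eta> \<epsilon>^2 / 2 each, more than the initial cost
      \<alpha> in total.\<close>
    define n where "n = nat \<lfloor>2 * \<alpha> / (\<eta> * \<epsilon>\<^sup>2)\<rfloor>"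
    have "0 \<le> \<alpha>" using J_nonneg inv J0 by metis
    then have b: "0 \<le> 2 * \<alpha> / (\<eta> * \<epsilon>\<^sup>2)" using \<eta>(1) by simp
    then have n: "real n \<le> 2 * \<alpha> / (\<eta> * \<epsilon>\<^sup>2)" "2 * \<alpha> / (\<eta> * \<epsilon>\<^sup>2) < real n + 1"
      unfolding n_def by linarith+
    have big: "\<epsilon>\<^sup>2 \<le> (norm (?g (K i)))\<^sup>2" if "i \<le> n" for i
    proof -
      have "real i \<le> 2 * \<alpha> / (\<eta> * \<epsilon>\<^sup>2)" using that n(1) by linarith
      then have "\<epsilon> < norm (?g (K i))" using neg by force
      then show ?thesis using \<open>\<epsilon> > 0\<close> by (intro power_mono) auto
    qed
    have "J (K i) \<le> \<alpha> - real i * (\<eta> / 2 * \<epsilon>\<^sup>2)" if "i \<le> Suc n" for i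
      using that
    proof (induction i)
      case (Suc i)
      have "\<eta> / 2 * \<epsilon>\<^sup>2 \<le> \<eta> / 2 * (norm (?g (K i)))\<^sup>2"
        using big[of i] Suc.prems \<eta>(1) by (intro mult_left_mono) auto
      moreover have "real (Suc i) * (\<eta> / 2 * \<epsilon>\<^sup>2) = real i * (\<eta> / 2 * \<epsilon>\<^sup>2) + \<eta> / 2 * \<epsilon>\<^sup>2"
        by (simp only: of_nat_Suc) (simp only: distrib_right mult_1_left add.commute)
      moreover have "J (K i) \<le> \<alpha> - real i * (\<eta> / 2 * \<epsilon>\<^sup>2)" using Suc by simp
      ultimately show ?case using decr[of i] by linarith
    qed (simp add: J0)
    from this[of "Suc n"] have "real (Suc n) * (\<eta> / 2 * \<epsilon>\<^sup>2) \<le> \<alpha>"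
      using J_nonneg[of "K (Suc n)"] inv[of "Suc n"] by linarith
    then have "real n + 1 \<le> 2 * \<alpha> / (\<eta> * \<epsilon>\<^sup>2)"
      using \<eta>(1) \<open>\<epsilon> > 0\<close> by (simp add: pos_le_divide_eq algebra_simps)
    then show False using n(2) by linarith
  qed
  have part3: "closed_segment (K i) (K (Suc i)) \<subseteq> sof_sublevel A B C Q R D \<alpha>" for i
  proof
    fix Y assume "Y \<in> closed_segment (K i) (K (Suc i))"
    then obtain u where u: "0 \<le> u" "u \<le> 1" "Y = (1 - u) *\<^sub>R K i + u *\<^sub>R K (Suc i)"
      by (auto simp: in_segment)
    \<comment> \<open>A point of the segment is a gradient step with the smaller step size u *
      \<eta>.\<close>
    have Y: "Y = K i - (u * \<eta>) *\<^sub>R ?g (K i)"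
      unfolding u(3) step by (simp add: algebra_simps)
    have "stab Y \<and> J Y \<le> J (K i) - (u * \<eta>) / 2 * (norm (?g (K i)))\<^sup>2"
      unfolding Y using inv[of i] u \<eta>(1) by (intro segment) (auto simp: mult_left_le_one_le)
    moreover have "0 \<le> (u * \<eta>) / 2 * (norm (?g (K i)))\<^sup>2" using u \<eta>(1) by simp
    ultimately have "stab Y" "J Y \<le> \<alpha>" using inv[of i] by auto
    then show "Y \<in> sof_sublevel A B C Q R D \<alpha>"
      by (simp add: sof_sublevel_def stabilizing_iff cost)
  qed
  have part4: "?J (K N) - sf_opt_cost A B Q R D \<le> \<epsilon>"
    if C: "CARD('d) = CARD('n)" "rank C = CARD('n)"
      and min: "is_arg_min ?J (\<lambda>K'. K' \<in> stabilizing A B C) Kstar" and "\<epsilon> > 0"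
      and N: "real N \<ge> opnorm (state_corr A B C D Kstar)
          / (2 * \<eta> * \<mu>\<^sup>2 * (sigma_min C)\<^sup>2 * sigma_min R)
          * ln ((?J (K 0) - sf_opt_cost A B Q R D) / \<epsilon>)"
    for Kstar \<epsilon> and N :: nat
  proof -
    have st: "stab Kstar" and le: "\<And>K. stab K \<Longrightarrow> J Kstar \<le> J K"
      using min by (auto simp: is_arg_min_def stabilizing_iff not_less cost)
    have opt: "sf_opt_cost A B Q R D = J Kstar"
      using sf_opt_cost_eq_sof_minimum[OF C min] cost[OF st] by simp
    have corr: "state_corr A B C D Kstar = S Kstar"
      using state_corr_eq[OF assms(10) st[unfolded M_def]] by (simp add: S_def M_def)
    have "inj ((*v) C)" using C(2) full_rank_injective by blast
    then have "C *v x = 0 \<Longrightarrow> x = 0" for x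
      by (metis injD matrix_vector_mult_0_right)
    then have sC: "0 < sigma_min C" using C(1) by (intro sigma_min_pos) auto
    have sR: "0 < sigma_min R" by (rule pos_def_sigma_min_pos[OF R])
    have pos: "0 < opnorm (S Kstar)" by (rule opnorm_S_pos[OF st])
    have mu: "0 < \<mu>" using mu_pos by (simp add: \<mu>_def)
    \<comment> \<open>By gradient domination the decrease \<eta>/2 |grad|^2 is at least c times the
      gap to the optimum; 1 / c is the factor in front of the logarithm.\<close>
    define c where "c = 2 * \<eta> * \<mu>\<^sup>2 * (sigma_min C)\<^sup>2 * sigma_min R / opnorm (S Kstar)"
    have c: "0 < c" using \<eta>(1) mu sC sR pos by (simp add: c_def)
    have "J (K N) - J Kstar \<le> \<epsilon>"
    proof (rule linear_rate[where \<delta> = "\<lambda>i. J (K i) - J Kstar" and c = c, OF _ _ c \<open>\<epsilon> > 0\<close>])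
      show "0 \<le> J (K i) - J Kstar" for i using le inv by simp
      show "J (K (Suc i)) - J Kstar \<le> (1 - c) * (J (K i) - J Kstar)" for i
      proof -
        have "J (K i) - J Kstar
            \<le> opnorm (S Kstar) / (4 * \<mu>\<^sup>2 * (sigma_min C)\<^sup>2 * sigma_min R) * (norm (?g (K i)))\<^sup>2"
          using gradient_domination[OF _ st _ sC, of "K i"] inv[of i] C(1)
          by (simp add: gradient \<mu>_def)
        then have "c * (J (K i) - J Kstar)
            \<le> c * (opnorm (S Kstar) / (4 * \<mu>\<^sup>2 * (sigma_min C)\<^sup>2 * sigma_min R) * (norm (?g (K i)))\<^sup>2)"
          using c by (intro mult_left_mono) auto
        also have "\<dots> = \<eta> / 2 * (norm (?g (K i)))\<^sup>2"
          using pos mu sC sR by (simp add: c_def field_simps)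
        finally show ?thesis using decr[of i] by (simp add: algebra_simps)
      qed
      have "1 / c = opnorm (state_corr A B C D Kstar) / (2 * \<eta> * \<mu>\<^sup>2 * (sigma_min C)\<^sup>2 * sigma_min R)"
        by (simp add: c_def corr)
      then show "1 / c * ln ((J (K 0) - J Kstar) / \<epsilon>) \<le> real N"
        using N by (simp add: opt cost_K)
    qed
    then show ?thesis by (simp add: opt cost_K)
  qed
  show ?thesis using part1 part2 part3 part4 by blast
qed

end
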